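(* Let Assumption 1 hold, let $\lambda>0$, let $\|\phi(s,a)\|_2\le1$ for all $(s,a)\in\mathcal X$, and let the data $\{(s_t,a_t,s_t',r_t')\}_{t=1}^N$ be adapted to a filtration $\{\mathcal F_t\}$ (i.e. $\{(s_\tau,a_\tau,s_\tau',r_\tau')\}_{\tau\le t}$ is $\mathcal F_t$-measurable), with $s_t'\sim p(\cdot\mid s_t,a_t)$ and $\mathbb E[r_t'\mid\cdot]=r(s_t,a_t)$, $r_t'\in[0,1]$, conditionally on $\mathcal F_{t-1}$ and $(s_t,a_t)$. Let $\omega:=\max\{\|w\|_2: 0\le\phi(s,a)^\top w\le1\ \forall(s,a)\in\mathcal X\}$. Then for any $\delta\in(0,1)$, with probability at least $1-\delta$, $$|v^\pi-\widehat v^\pi|\le\sum_{h=0}^H(H-h+1)\sqrt{(\widehat\nu_h^\pi)^\top\widehat\Sigma^{-1}\widehat\nu_h^\pi}\cdot\Big(\sqrt{2\lambda}\,\omega+2\sqrt{2d\ln\big(1+\tfrac{N}{\lambda d}\big)\ln\big(\tfrac{3N^2H}{\delta}\big)}+\tfrac43\ln\big(\tfrac{3N^2H}{\delta}\big)\Big),$$ where $\widehat\nu_h^\pi:=((\widehat M^\pi)^\top)^h\nu_0^\pi$.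
   Context: MDP setting: $\mathcal X=\mathcal S\times\mathcal A$; rewards $r'\in[0,1]$ with mean $r(s,a)$, next state $s'\sim p(\cdot\mid s,a)$; target policy $\pi$, horizon $H$, initial distribution $\xi_0$; $v^\pi=\mathbb E^\pi[\sum_{h=0}^Hr(s_h,a_h)\mid s_0\sim\xi_0]$. $\phi:\mathcal X\to\mathbb R^d$, $\mathcal Q=\{\phi^\top w\}$, $\phi^\pi(s)=\int\phi(s,a)\pi(a\mid s)da$, $\mathcal P^\pi f(s,a)=\mathbb E[f(s',a')\mid s,a]$ with $s'\sim p(\cdot\mid s,a),a'\sim\pi(\cdot\mid s')$. Assumption 1: $r\in\mathcal Q$ and $\mathcal P^\pi\mathcal Q\subseteq\mathcal Q$. Estimator: $\widehat\Sigma=\lambda I+\sum_t\phi(s_t,a_t)\phi(s_t,a_t)^\top$, $\widehat R=\widehat\Sigma^{-1}\sum_tr_t'\phi(s_t,a_t)$, $\widehat M^\pi=\widehat\Sigma^{-1}\sum_t\phi(s_t,a_t)\phi^\pi(s_t')^\top$, $\nu_0^\pi=\mathbb E[\phi(s,a)\mid s\sim\xi_0,a\sim\pi(\cdot\mid s)]$, $\widehat w_{H+1}^\pi=0$, $\widehat w_h^\pi=\widehat R+\widehat M^\pi\widehat w_{h+1}^\pi$ ($h=H,\dots,0$), $\widehat v^\pi=(\nu_0^\pi)^\top\widehat w_0^\pi$. *)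

theory Defs
  imports "HOL-Probability.Probability"
begin

definition outer :: "real^'d \<Rightarrow> real^'e \<Rightarrow> real^'e^'d" where
  "outer x y = (\<chi> i j. x $ i * y $ j)"

definition phi_pi :: "('s \<Rightarrow> 'a measure) \<Rightarrow> ('s \<Rightarrow> 'a \<Rightarrow> real^'d) \<Rightarrow> 's \<Rightarrow> real^'d" where
  "phi_pi \<pi> \<phi> s = (\<integral>a. \<phi> s a \<partial>\<pi> s)"

definition Ppi :: "('s \<times> 'a \<Rightarrow> 's measure) \<Rightarrow> ('s \<Rightarrow> 'a measure) \<Rightarrow> ('s \<Rightarrow> 'a \<Rightarrow> real) \<Rightarrow> 's \<Rightarrow> 'a \<Rightarrow> real" where
  "Ppi p \<pi> f s a = (\<integral>s'. (\<integral>a'. f s' a' \<partial>\<pi> s') \<partial>p (s, a))"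

text \<open>Qval k = Q_{H-k}: expected sum of the rewards of the remaining k+1 steps
  (Q_H = r, Q_h = r + P^pi Q_{h+1}), i.e. the iterated-integral form of the
  trajectory expectation.\<close>
fun Qval :: "('s \<times> 'a \<Rightarrow> 's measure) \<Rightarrow> ('s \<Rightarrow> 'a measure) \<Rightarrow> ('s \<Rightarrow> 'a \<Rightarrow> real) \<Rightarrow> nat \<Rightarrow> 's \<Rightarrow> 'a \<Rightarrow> real" where
  "Qval p \<pi> r 0 = r"
| "Qval p \<pi> r (Suc k) = (\<lambda>s a. r s a + Ppi p \<pi> (Qval p \<pi> r k) s a)"

text \<open>v^pi = E^pi[sum_{h=0}^H r(s_h,a_h) | s_0 ~ xi_0]\<close>
definition vpi :: "'s measure \<Rightarrow> ('s \<times> 'a \<Rightarrow> 's measure) \<Rightarrow> ('s \<Rightarrow> 'a measure) \<Rightarrow> ('s \<Rightarrow> 'a \<Rightarrow> real) \<Rightarrow> nat \<Rightarrow> real" where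
  "vpi \<xi>0 p \<pi> r H = (\<integral>s. (\<integral>a. Qval p \<pi> r H s a \<partial>\<pi> s) \<partial>\<xi>0)"

definition nu0 :: "'s measure \<Rightarrow> ('s \<Rightarrow> 'a measure) \<Rightarrow> ('s \<Rightarrow> 'a \<Rightarrow> real^'d) \<Rightarrow> real^'d" where
  "nu0 \<xi>0 \<pi> \<phi> = (\<integral>s. (\<integral>a. \<phi> s a \<partial>\<pi> s) \<partial>\<xi>0)"

definition SigmaHat :: "real \<Rightarrow> ('s \<Rightarrow> 'a \<Rightarrow> real^'d) \<Rightarrow> nat \<Rightarrow> (nat \<Rightarrow> 's) \<Rightarrow> (nat \<Rightarrow> 'a) \<Rightarrow> real^'d^'d" where
  "SigmaHat lam \<phi> N ss as = lam *\<^sub>R mat 1 + (\<Sum>t=1..N. outer (\<phi> (ss t) (as t)) (\<phi> (ss t) (as t)))"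

definition RHat :: "real \<Rightarrow> ('s \<Rightarrow> 'a \<Rightarrow> real^'d) \<Rightarrow> nat \<Rightarrow> (nat \<Rightarrow> 's) \<Rightarrow> (nat \<Rightarrow> 'a) \<Rightarrow> (nat \<Rightarrow> real) \<Rightarrow> real^'d" where
  "RHat lam \<phi> N ss as rs = matrix_inv (SigmaHat lam \<phi> N ss as) *v (\<Sum>t=1..N. rs t *\<^sub>R \<phi> (ss t) (as t))"

definition MHat :: "real \<Rightarrow> ('s \<Rightarrow> 'a \<Rightarrow> real^'d) \<Rightarrow> ('s \<Rightarrow> 'a measure) \<Rightarrow> nat \<Rightarrow> (nat \<Rightarrow> 's) \<Rightarrow> (nat \<Rightarrow> 'a) \<Rightarrow> (nat \<Rightarrow> 's) \<Rightarrow> real^'d^'d" where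
  "MHat lam \<phi> \<pi> N ss as ss' = matrix_inv (SigmaHat lam \<phi> N ss as) **
      (\<Sum>t=1..N. outer (\<phi> (ss t) (as t)) (phi_pi \<pi> \<phi> (ss' t)))"

text \<open>west R M k = w_{H+1-k}: w_{H+1} = 0, w_h = R + M w_{h+1}\<close>
fun west :: "real^'d \<Rightarrow> real^'d^'d \<Rightarrow> nat \<Rightarrow> real^'d" where
  "west R M 0 = 0"
| "west R M (Suc k) = R + M *v west R M k"

definition vhat :: "nat \<Rightarrow> real^'d \<Rightarrow> real^'d \<Rightarrow> real^'d^'d \<Rightarrow> real" where
  "vhat H \<nu> R M = \<nu> \<bullet> west R M (Suc H)"

definition nuhat :: "real^'d^'d \<Rightarrow> real^'d \<Rightarrow> nat \<Rightarrow> real^'d" where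
  "nuhat M \<nu> h = ((\<lambda>v. transpose M *v v) ^^ h) \<nu>"

text \<open>omega = max {||w|| : 0 <= phi(s,a)^T w <= 1 for all (s,a)}, taken in ereal
  (a supremum; it is infinite iff the set is unbounded).\<close>
definition omega :: "'s measure \<Rightarrow> 'a measure \<Rightarrow> ('s \<Rightarrow> 'a \<Rightarrow> real^'d) \<Rightarrow> ereal" where
  "omega S A \<phi> = Sup {ereal (norm w) | w. \<forall>s\<in>space S. \<forall>a\<in>space A. 0 \<le> \<phi> s a \<bullet> w \<and> \<phi> s a \<bullet> w \<le> 1}"

definition cond_sigma :: "'w measure \<Rightarrow> 'w measure \<Rightarrow> ('w \<Rightarrow> 'b) \<Rightarrow> 'b measure \<Rightarrow> 'w measure" where
  "cond_sigma M G X SA = sigma (space M) (sets G \<union> {X -` B \<inter> space M | B. B \<in> sets SA})"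

end

theory Submission
  imports Defs
begin

text \<open>
  Writing \<open>W\<close> for the inverse of the regularised Gram matrix and \<open>w\<^sub>h\<close> for the parameter of the true
  \<open>Q\<close>-function, the recursion for the estimator unrolls to an estimation error
  \<open>\<Sum>\<^sub>h \<nu>\<^sub>h \<bullet> W (T\<^sub>h - lam w\<^sub>h)\<close>, where \<open>T\<^sub>h = \<Sum>\<^sub>t \<epsilon>\<^sub>t \<phi>\<^sub>t\<close> and the \<open>\<epsilon>\<^sub>t\<close> are the Bellman residuals, martingale
  differences taking values in an interval of length \<open>H - h + 1\<close>. Cauchy--Schwarz in the \<open>W\<close>-norm
  reduces the claim to a bound on \<open>Z = T \<bullet> W T\<close>.

  After normalisation of the residuals, Sherman--Morrison gives
  \<open>Z\<^sub>t = Z\<^sub>t\<^sub>-\<^sub>1 + (2 \<epsilon> b - b\<^sup>2 + \<epsilon>\<^sup>2 u) / (1 + u)\<close> with \<open>u = \<phi>\<^sub>t \<bullet> W \<phi>\<^sub>t\<close> and \<open>b = T \<bullet> W \<phi>\<^sub>t\<close>. By Hoeffding's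
  lemma the term \<open>- b\<^sup>2\<close> absorbs the exponential moment of \<open>2 \<epsilon> b\<close>, so
  \<open>exp (2 Z\<^sub>t - 2 \<Sum> u / (1 + u))\<close> is a supermartingale and Markov's inequality applies. Finally
  \<open>\<Sum> u / (1 + u) \<le> \<Sum> ln (1 + u)\<close>, which is the logarithm of a determinant ratio and is bounded by
  Hadamard's inequality and \<open>ln y \<le> y - 1\<close>. This sub-Gaussian argument gives slightly more than the
  Bernstein-type radius of the statement.
\<close>

subsection \<open>Rank-one updates and Hadamard's inequality\<close>

lemma outer_mult_vec: "outer x y *v z = (y \<bullet> z) *\<^sub>R x"
  by (simp add: outer_def matrix_vector_mult_def inner_vec_def vec_eq_iff sum_distrib_left
      sum_distrib_right mult_ac)

lemma sum_matrix_vector_mult: "(\<Sum>t\<in>T. A t) *v z = (\<Sum>t\<in>T. A t *v z)"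
  for A :: "'t \<Rightarrow> real^'n^'m"
  by (induction T rule: infinite_finite_induct) (auto simp: matrix_vector_mult_add_rdistrib)

text \<open>The vector \<open>y\<close> combines the unit rows with coefficients
  \<open>y $ i\<close>, so Cramer's lemma for rows applies to the identity matrix.\<close>

lemma det_replace_row_mat1: "det (\<chi> i. if i = k then y else axis i 1) = y $ k"
  for y :: "real^'n"
proof -
  have "(\<chi> i. if i = k then y else axis i 1) =
     (\<chi> i. if i = k then (\<Sum>i\<in>UNIV. y$i *s row i (mat 1 :: real^'n^'n)) else row i (mat 1 :: real^'n^'n))"
    by (simp add: vec_eq_iff row_def mat_def axis_def sum_component if_distrib cong: if_cong)
  then show ?thesis
    using cramer_lemma_transpose[of k y "mat 1 :: real^'n^'n"] by simp
qed

text \<open>Since row \<open>k\<close> is \<open>y\<close> itself, adding multiples of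
  \<open>y\<close> to other rows changes nothing: by multilinearity each addition contributes a
  determinant with two equal rows.\<close>

lemma det_rank_one_rows_replace:
  fixes x y :: "real^'n"
  assumes "finite K" "k \<notin> K"
  shows "det (\<chi> i. if i = k then y else if i \<in> K then axis i 1 + x $ i *s y else axis i 1) = y $ k"
  using assms
proof (induction K rule: finite_induct)
  case empty
  then show ?case using det_replace_row_mat1[of k y] by (simp cong: if_cong)
next
  case (insert j K)
  define c where "c i = (if i = k then y else if i \<in> K then axis i 1 + x $ i *s y else axis i 1)" for i
  have jk: "j \<noteq> k" using insert by auto
  have 1: "(\<chi> i. if i = k then y else if i \<in> insert j K then axis i 1 + x $ i *s y else axis i 1)
      = (\<chi> i. if i = j then axis j 1 + x $ j *s y else c i)"
    using insert by (auto simp: c_def vec_eq_iff)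
  have 2: "(\<chi> i. if i = j then axis j 1 else c i) = (\<chi> i. c i)"
    using insert jk by (auto simp: c_def vec_eq_iff)
  have 3: "det (\<chi> i. if i = j then y else c i) = 0"
    by (rule det_identical_rows[OF jk]) (simp add: row_def c_def jk)
  show ?case
    unfolding 1 det_row_add det_row_mul 2 3 using insert by (simp add: c_def[abs_def])
qed

text \<open>The matrix determinant lemma, perturbing one row at a time. Perturbing row
  \<open>k\<close> adds \<open>x $ k\<close> times a determinant whose row \<open>k\<close> is
  \<open>y\<close>; the previous lemma evaluates it even though other rows are already
  perturbed.\<close>

lemma det_mat1_plus_outer: "det (mat 1 + outer x y) = 1 + x \<bullet> y"
  for x y :: "real^'n"
proof -
  have "det (\<chi> i. if i \<in> K then axis i 1 + x $ i *s y else axis i 1) = 1 + (\<Sum>i\<in>K. x $ i * y $ i)"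
    if "finite K" for K :: "'n set"
    using that
  proof (induction K rule: finite_induct)
    case empty
    have "(\<chi> i. axis i 1) = (mat 1 :: real^'n^'n)"
      by (simp add: vec_eq_iff mat_def axis_def)
    then show ?case by simp
  next
    case (insert k K)
    define c where "c i = (if i \<in> K then axis i 1 + x $ i *s y else axis i 1)" for i
    have 1: "(\<chi> i. if i \<in> insert k K then axis i 1 + x $ i *s y else axis i 1)
      = (\<chi> i. if i = k then axis k 1 + x $ k *s y else c i)"
      using insert by (auto simp: c_def vec_eq_iff)
    have 2: "(\<chi> i. if i = k then axis k 1 else c i) = (\<chi> i. c i)"
      using insert by (auto simp: c_def vec_eq_iff)
    have 3: "det (\<chi> i. if i = k then y else c i) = y $ k"
      unfolding c_def using insert by (intro det_rank_one_rows_replace)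
    show ?case
      unfolding 1 det_row_add det_row_mul 2 3 using insert by (simp add: c_def[abs_def])
  qed
  from this[of UNIV] have "det (\<chi> i. axis i 1 + x $ i *s y) = 1 + x \<bullet> y"
    by (simp add: inner_vec_def)
  moreover have "mat 1 + outer x y = (\<chi> i. axis i 1 + x $ i *s y)"
    by (simp add: vec_eq_iff outer_def mat_def axis_def)
  ultimately show ?thesis by simp
qed

text \<open>Hadamard's inequality, by symmetric Gaussian elimination: each step is a congruence by a
  matrix of determinant 1 that decouples one more index and does not increase the diagonal.\<close>
lemma det_le_prod_diag:
  fixes V :: "real^'n^'n"
  assumes "\<And>i j. V$i$j = V$j$i" "\<And>x. x \<noteq> 0 \<Longrightarrow> x \<bullet> (V *v x) > 0"
  shows "det V \<le> (\<Prod>i\<in>UNIV. V$i$i)"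
proof -
  have diag_pos: "V$k$k > 0" if "\<And>x. x \<noteq> 0 \<Longrightarrow> x \<bullet> (V *v x) > 0" for V :: "real^'n^'n" and k
    using that[of "axis k 1"]
    by (simp add: matrix_vector_mult_basis column_def inner_axis' axis_eq_0_iff)
  \<comment> \<open>\<open>K\<close> holds the indices not yet eliminated: a row outside
    \<open>K\<close> has no off-diagonal entry left. The lemma is the case \<open>K = UNIV\<close>,
    and \<open>K = {}\<close> leaves a diagonal matrix.\<close>
  have "det V \<le> (\<Prod>i\<in>UNIV. V$i$i)"
    if "finite K" "\<And>i j. V$i$j = V$j$i" "\<And>x. x \<noteq> 0 \<Longrightarrow> x \<bullet> (V *v x) > 0"
      "\<And>i j. i \<noteq> j \<Longrightarrow> i \<notin> K \<Longrightarrow> V$i$j = 0" for V :: "real^'n^'n" and K :: "'n set"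
    using that
  proof (induction K arbitrary: V rule: finite_induct)
    case empty
    then show ?case by (subst det_diagonal) auto
  next
    case (insert k K)
    note sym = insert.prems(1) and pd = insert.prems(2) and off = insert.prems(3)
    \<comment> \<open>Gaussian multipliers: \<open>E\<close> subtracts \<open>g $ i\<close> times
      row \<open>k\<close> from row \<open>i\<close>, and the congruence does the same to the
      columns. The value 0 at \<open>k\<close> preserves the pivot and makes
      \<open>det E = 1\<close>.\<close>
    define g where "g = (\<chi> i. if i = k then 0 else V$i$k / V$k$k)"
    define E where "E = mat 1 + outer (- g) (axis k 1)"
    define V' where "V' = E ** V ** transpose E"
    have vk: "V$k$k > 0" using diag_pos[OF pd] .
    have detE: "det E = 1"
      unfolding E_def det_mat1_plus_outer by (simp add: inner_axis g_def)
    have detV': "det V' = det V"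
      by (simp add: V'_def det_mul detE det_transpose)
    have E_mult: "E$i$l * z = (if l = i then z else 0) - (if l = k then g$i * z else 0)" for i l z
      by (simp add: E_def outer_def mat_def axis_def algebra_simps)
    have EV: "(E ** V)$i$j = V$i$j - g$i * V$k$j" for i j
      by (simp add: matrix_matrix_mult_def E_mult sum_subtractf)
    have V'_nth: "V'$i$j = V$i$j - g$i * V$k$j - g$j * (V$i$k - g$i * V$k$k)" for i j
    proof -
      have "V'$i$j = (\<Sum>l\<in>UNIV. E$j$l * (E ** V)$i$l)"
        by (simp add: V'_def matrix_matrix_mult_def[of "E ** V"] transpose_def mult.commute)
      also have "\<dots> = (E ** V)$i$j - g$j * (E ** V)$i$k"
        by (simp add: E_mult sum_subtractf)
      finally show ?thesis by (simp add: EV)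
    qed
    have pd': "x \<bullet> (V' *v x) > 0" if "x \<noteq> 0" for x
    proof -
      have "invertible (transpose E)"
        using detE by (simp add: invertible_det_nz)
      then obtain B where "B ** transpose E = mat 1"
        by (auto simp: invertible_def)
      then have "B *v (transpose E *v x) = x"
        by (simp only: matrix_vector_mul_assoc matrix_vector_mul_lid)
      then have "transpose E *v x \<noteq> 0"
        using that by auto
      then have "0 < (transpose E *v x) \<bullet> (V *v (transpose E *v x))"
        by (rule pd)
      also have "\<dots> = x \<bullet> (V' *v x)"
        by (simp add: V'_def dot_lmul_matrix matrix_vector_mul_assoc[symmetric])
      finally show ?thesis .
    qed
    have "det V' \<le> (\<Prod>i\<in>UNIV. V'$i$i)"
    proof (rule insert.IH)
      show "V'$i$j = V'$j$i" for i j
        using sym by (simp add: V'_nth algebra_simps)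
      show "x \<bullet> (V' *v x) > 0" if "x \<noteq> 0" for x using pd' that .
      show "V'$i$j = 0" if "i \<noteq> j" "i \<notin> K" for i j
      proof (cases "i = k")
        case True
        then show ?thesis using that vk sym[of k j] by (simp add: V'_nth g_def)
      next
        case False
        then have "V$i$j = 0" "V$i$k = 0" using off that by auto
        then show ?thesis using False by (simp add: V'_nth g_def)
      qed
    qed
    also have "\<dots> \<le> (\<Prod>i\<in>UNIV. V$i$i)"
    proof (rule prod_mono, intro conjI)
      fix i
      \<comment> \<open>Diagonal of the Schur complement: apart from the pivot, each entry loses a
        square divided by the positive pivot.\<close>
      have V'ii: "V'$i$i = (if i = k then V$k$k else V$i$i - (V$i$k)\<^sup>2 / V$k$k)"
        using vk sym[of k i] by (simp add: V'_nth g_def power2_eq_square field_simps)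
      show "V'$i$i \<le> V$i$i"
        using vk by (simp add: V'ii)
      show "0 \<le> V'$i$i"
        using diag_pos[OF pd'] by (simp add: less_imp_le)
    qed
    finally show ?case by (simp add: detV')
  qed
  from this[of UNIV V] assms show ?thesis by auto
qed

text \<open>\<open>matrix_inv\<close> is a choice of some two-sided inverse. For square matrices a
  right inverse is two-sided, and two-sided inverses are unique.\<close>

lemma matrix_inv_eqI:
  fixes A B :: "real^'n^'n"
  assumes "A ** B = mat 1"
  shows "matrix_inv A = B"
proof -
  have "B ** A = mat 1"
    using assms by (simp add: matrix_left_right_inverse)
  with assms have "A ** B = mat 1 \<and> B ** A = mat 1"
    by simp
  then have inv: "A ** matrix_inv A = mat 1 \<and> matrix_inv A ** A = mat 1"
    unfolding matrix_inv_def by (rule someI)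
  have "matrix_inv A = (B ** A) ** matrix_inv A"
    using \<open>B ** A = mat 1\<close> by simp
  also have "\<dots> = B"
    using inv by (simp only: matrix_mul_assoc[symmetric] matrix_mul_rid)
  finally show ?thesis .
qed

subsection \<open>Regularised Gram matrices\<close>

text \<open>\<open>SigmaHat\<close> with an abstract feature sequence and a variable sample size, so
  that induction on \<open>n\<close> is available.\<close>

definition gram :: "real \<Rightarrow> (nat \<Rightarrow> real^'d) \<Rightarrow> nat \<Rightarrow> real^'d^'d" where
  "gram lam x n = lam *\<^sub>R mat 1 + (\<Sum>t=1..n. outer (x t) (x t))"

text \<open>The inverse of \<^const>\<open>gram\<close> by iterated Sherman--Morrison updates; unlike \<^const>\<open>matrix_inv\<close>,
  this form is visibly measurable in the data.\<close>
fun gram_inv :: "real \<Rightarrow> (nat \<Rightarrow> real^'d) \<Rightarrow> nat \<Rightarrow> real^'d^'d" where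
  "gram_inv lam x 0 = (1 / lam) *\<^sub>R mat 1"
| "gram_inv lam x (Suc n) = gram_inv lam x n -
    (1 / (1 + x (Suc n) \<bullet> (gram_inv lam x n *v x (Suc n)))) *\<^sub>R
      outer (gram_inv lam x n *v x (Suc n)) (gram_inv lam x n *v x (Suc n))"

declare gram_inv.simps(2) [simp del]

text \<open>The leverage of the next point: the Gram matrix is that of the first \<open>n\<close>
  features, the vector is number \<open>Suc n\<close>. This is the \<open>u\<close> of the
  overview.\<close>

definition gram_lev :: "real \<Rightarrow> (nat \<Rightarrow> real^'d) \<Rightarrow> nat \<Rightarrow> real" where
  "gram_lev lam x n = x (Suc n) \<bullet> (gram_inv lam x n *v x (Suc n))"

definition noise_sum :: "(nat \<Rightarrow> real^'d) \<Rightarrow> (nat \<Rightarrow> real) \<Rightarrow> nat \<Rightarrow> real^'d" where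
  "noise_sum x e n = (\<Sum>t=1..n. e t *\<^sub>R x t)"

text \<open>The self-normalised squared norm of the noise vector, the \<open>Z\<close> of the
  overview.\<close>

definition noise_sqnorm :: "real \<Rightarrow> (nat \<Rightarrow> real^'d) \<Rightarrow> (nat \<Rightarrow> real) \<Rightarrow> nat \<Rightarrow> real" where
  "noise_sqnorm lam x e n = noise_sum x e n \<bullet> (gram_inv lam x n *v noise_sum x e n)"

lemma gram_Suc: "gram lam x (Suc n) = gram lam x n + outer (x (Suc n)) (x (Suc n))"
  by (simp add: gram_def)

lemma gram_mult_vec: "gram lam x n *v z = lam *\<^sub>R z + (\<Sum>t=1..n. (x t \<bullet> z) *\<^sub>R x t)"
  by (simp add: gram_def matrix_vector_mult_add_rdistrib sum_matrix_vector_mult outer_mult_vec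
      scaleR_matrix_vector_assoc[symmetric])

lemma gram_symmetric: "u \<bullet> (gram lam x n *v z) = (gram lam x n *v u) \<bullet> z"
  by (simp add: gram_mult_vec inner_add_left inner_add_right inner_sum_left inner_sum_right
      inner_commute mult.commute)

lemma gram_quadratic: "u \<bullet> (gram lam x n *v u) = lam * (u \<bullet> u) + (\<Sum>t=1..n. (x t \<bullet> u)\<^sup>2)"
  by (simp add: gram_mult_vec inner_add_right inner_sum_right inner_commute power2_eq_square)

lemma gram_quadratic_ge: "lam * (u \<bullet> u) \<le> u \<bullet> (gram lam x n *v u)"
  unfolding gram_quadratic by (simp add: sum_nonneg)

lemma gram_inv_Suc_mult_vec:
  fixes x :: "nat \<Rightarrow> real^'d" and n :: nat and lam :: real
  defines "y \<equiv> gram_inv lam x n *v x (Suc n)"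
  shows "gram_inv lam x (Suc n) *v z =
    gram_inv lam x n *v z - ((y \<bullet> z) / (1 + x (Suc n) \<bullet> y)) *\<^sub>R y"
  by (simp add: gram_inv.simps y_def matrix_vector_mult_diff_rdistrib
      outer_mult_vec scaleR_matrix_vector_assoc[symmetric])

text \<open>Symmetry is inherited from \<open>gram\<close> by writing both arguments as images under
  it. \<open>W\<close> is an arbitrary right inverse because the fact serves inside the induction
  that proves \<open>gram_inv\<close> to be one.\<close>

lemma gram_right_inverse_symmetric:
  assumes "\<And>z. gram lam x n *v (W *v z) = z"
  shows "u \<bullet> (W *v z) = (W *v u) \<bullet> z"
  by (metis assms gram_symmetric)

lemma gram_right_inverse_quadratic_ge:
  assumes "\<And>z. gram lam x n *v (W *v z) = z"
  shows "lam * ((W *v z) \<bullet> (W *v z)) \<le> z \<bullet> (W *v z)"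
  by (metis assms(1) gram_quadratic_ge gram_symmetric)

lemma gram_gram_inv_vec:
  assumes lam: "lam > 0"
  shows "gram lam x n *v (gram_inv lam x n *v z) = z"
proof (induction n arbitrary: z)
  case 0
  then show ?case
    using lam by (simp add: gram_mult_vec scaleR_matrix_vector_assoc[symmetric])
next
  case (Suc n)
  define W where "W = gram_inv lam x n"
  define v where "v = x (Suc n)"
  define y where "y = W *v v"
  have inv: "gram lam x n *v (W *v z) = z" for z
    using Suc by (simp add: W_def)
  have "0 \<le> lam * ((W *v v) \<bullet> (W *v v))"
    using lam by simp
  then have pos: "1 + v \<bullet> y > 0"
    using gram_right_inverse_quadratic_ge[OF inv, of v] by (simp add: y_def)
  have yz: "y \<bullet> z = v \<bullet> (W *v z)"
    by (simp add: y_def gram_right_inverse_symmetric[OF inv])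
  have Vy: "gram lam x n *v y = v"
    by (simp add: y_def inv)
  have "gram_inv lam x (Suc n) *v z = W *v z - ((y \<bullet> z) / (1 + v \<bullet> y)) *\<^sub>R y"
    by (simp add: gram_inv_Suc_mult_vec W_def v_def y_def)
  \<comment> \<open>The enlarged Gram matrix sends \<open>y\<close> to
    \<open>(1 + v \<bullet> y) *\<^sub>R v\<close>, so the Sherman--Morrison correction cancels
    exactly the surplus multiple of \<open>v\<close>.\<close>
  then have "gram lam x (Suc n) *v (gram_inv lam x (Suc n) *v z)
    = z + (v \<bullet> (W *v z)) *\<^sub>R v - ((y \<bullet> z) / (1 + v \<bullet> y)) *\<^sub>R ((1 + v \<bullet> y) *\<^sub>R v)"
    by (simp add: gram_Suc matrix_vector_mult_add_rdistrib matrix_vector_mult_diff_distrib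
        outer_mult_vec inv v_def[symmetric] matrix_vector_mult_scaleR Vy inner_diff_right
        scaleR_left_diff_distrib scaleR_right_distrib scaleR_left_distrib distrib_left add_divide_distrib)
  also have "\<dots> = z"
    using pos by (simp add: yz)
  finally show ?case .
qed

lemma gram_inv_symmetric:
  assumes "lam > 0"
  shows "u \<bullet> (gram_inv lam x n *v z) = (gram_inv lam x n *v u) \<bullet> z"
  by (rule gram_right_inverse_symmetric[OF gram_gram_inv_vec[OF assms]])

lemma gram_inv_quadratic_ge:
  assumes "lam > 0"
  shows "lam * (norm (gram_inv lam x n *v z))\<^sup>2 \<le> z \<bullet> (gram_inv lam x n *v z)"
  using gram_right_inverse_quadratic_ge[OF gram_gram_inv_vec[OF assms]] by (simp add: power2_norm_eq_inner)

lemma gram_inv_nonneg: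
  assumes "lam > 0"
  shows "0 \<le> z \<bullet> (gram_inv lam x n *v z)"
  using gram_inv_quadratic_ge[OF assms, of x n z] assms
  by (meson mult_nonneg_nonneg order_trans less_imp_le zero_le_power2)

lemma gram_lev_nonneg: "lam > 0 \<Longrightarrow> 0 \<le> gram_lev lam x n"
  unfolding gram_lev_def by (rule gram_inv_nonneg)

text \<open>For \<open>y = W z\<close>, the lower bound and Cauchy--Schwarz give
  \<open>lam * (norm y)\<^sup>2 \<le> norm z * norm y\<close>; cancelling \<open>norm y\<close>
  bounds \<open>y\<close>, and a second use of Cauchy--Schwarz bounds the form.\<close>

lemma gram_inv_quadratic_le:
  assumes "lam > 0"
  shows "lam * (z \<bullet> (gram_inv lam x n *v z)) \<le> (norm z)\<^sup>2"
proof -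
  define y where "y = gram_inv lam x n *v z"
  have 1: "lam * (norm y)\<^sup>2 \<le> z \<bullet> y"
    using gram_inv_quadratic_ge[OF assms] by (simp add: y_def)
  have 2: "z \<bullet> y \<le> norm z * norm y"
    by (rule norm_cauchy_schwarz)
  have "lam * (norm y)\<^sup>2 \<le> norm z * norm y"
    using 1 2 by simp
  then have "lam * norm y \<le> norm z"
    by (cases "y = 0") (simp_all add: power2_eq_square flip: mult.assoc)
  then have "lam * norm y * norm z \<le> norm z * norm z"
    by (rule mult_right_mono) simp
  moreover have "lam * (z \<bullet> y) \<le> lam * (norm z * norm y)"
    using 2 assms by simp
  ultimately show ?thesis
    unfolding y_def[symmetric] power2_eq_square by (simp add: mult_ac)
qed

lemma gram_inv_Cauchy_Schwarz:
  fixes x :: "nat \<Rightarrow> real^'d" and n :: nat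
  assumes "lam > 0"
  defines "W \<equiv> gram_inv lam x n"
  shows "\<bar>u \<bullet> (W *v z)\<bar> \<le> sqrt (u \<bullet> (W *v u)) * sqrt (z \<bullet> (W *v z))"
proof -
  define a where "a = u \<bullet> (W *v u)"
  define b where "b = u \<bullet> (W *v z)"
  define c where "c = z \<bullet> (W *v z)"
  have nn: "0 \<le> v \<bullet> (W *v v)" for v
    unfolding W_def by (rule gram_inv_nonneg[OF assms(1)])
  have sym: "z \<bullet> (W *v u) = b"
    unfolding b_def W_def by (subst gram_inv_symmetric[OF assms(1)]) (simp add: inner_commute)
  have q: "0 \<le> s\<^sup>2 * a + 2 * s * t * b + t\<^sup>2 * c" for s t
    using nn[of "s *\<^sub>R u + t *\<^sub>R z"] sym
    by (simp add: matrix_vector_right_distrib matrix_vector_mult_scaleR inner_add_left inner_add_right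
        a_def[symmetric] b_def[symmetric] c_def[symmetric] algebra_simps power2_eq_square)
  have a: "0 \<le> a" and c: "0 \<le> c"
    using nn by (auto simp: a_def c_def)
  have "b\<^sup>2 \<le> a * c"
  proof (cases "c = 0")
    case True
    have "b = 0"
    proof (rule ccontr)
      assume "b \<noteq> 0"
      \<comment> \<open>With \<open>c = 0\<close> the form is affine in \<open>t\<close>; this
        witness gives it the value -1.\<close>
      then show False
        using q[of 1 "- (a + 1) / (2 * b)"] True a by (simp add: field_simps)
    qed
    then show ?thesis using True by simp
  next
    case False
    then have "c > 0" using c by simp
    \<comment> \<open>The minimising direction \<open>s = c\<close>, \<open>t = - b\<close> of the
      quadratic form.\<close>
    have "0 \<le> c * (a * c - b\<^sup>2)"
      using q[of c "- b"] by (simp add: algebra_simps power2_eq_square)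
    then show ?thesis
      using \<open>c > 0\<close> by (simp add: zero_le_mult_iff)
  qed
  then have "\<bar>b\<bar> \<le> sqrt (a * c)"
    by (intro real_le_rsqrt) simp
  then show ?thesis
    by (simp add: a_def b_def c_def real_sqrt_mult)
qed

lemma sqrt_gram_inv_quadratic_triangle:
  fixes x :: "nat \<Rightarrow> real^'d" and n :: nat
  assumes "lam > 0"
  defines "W \<equiv> gram_inv lam x n"
  shows "sqrt ((u - z) \<bullet> (W *v (u - z))) \<le> sqrt (u \<bullet> (W *v u)) + sqrt (z \<bullet> (W *v z))"
proof -
  have nn: "0 \<le> v \<bullet> (W *v v)" for v
    unfolding W_def by (rule gram_inv_nonneg[OF assms(1)])
  have sym: "z \<bullet> (W *v u) = u \<bullet> (W *v z)"
    unfolding W_def by (subst gram_inv_symmetric[OF assms(1)]) (simp add: inner_commute)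
  have "(u - z) \<bullet> (W *v (u - z)) = u \<bullet> (W *v u) - 2 * (u \<bullet> (W *v z)) + z \<bullet> (W *v z)"
    using sym by (simp add: matrix_vector_mult_diff_distrib inner_diff_left inner_diff_right)
  also have "\<dots> \<le> (sqrt (u \<bullet> (W *v u)) + sqrt (z \<bullet> (W *v z)))\<^sup>2"
    using gram_inv_Cauchy_Schwarz[OF assms(1), of u x n z] nn
    by (simp add: power2_sum W_def[symmetric] abs_le_iff)
  finally show ?thesis
    using nn by (intro real_le_lsqrt) auto
qed

text \<open>Factoring the old Gram matrix out of the rank-one update leaves
  \<open>mat 1 + outer y v\<close> with \<open>y = W v\<close>, to which the matrix determinant
  lemma applies.\<close>

lemma det_gram_Suc:
  assumes "lam > 0"
  shows "det (gram lam x (Suc n)) = det (gram lam x n) * (1 + gram_lev lam x n)"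
proof -
  define v where "v = x (Suc n)"
  define y where "y = gram_inv lam x n *v v"
  have "gram lam x n ** (mat 1 + outer y v) *v z = gram lam x (Suc n) *v z" for z
    by (simp add: matrix_vector_mul_assoc[symmetric] matrix_vector_mult_add_rdistrib gram_Suc
        outer_mult_vec matrix_vector_right_distrib matrix_vector_mult_scaleR
        v_def[symmetric]) (simp add: y_def gram_gram_inv_vec[OF assms])
  then have "gram lam x (Suc n) = gram lam x n ** (mat 1 + outer y v)"
    by (simp add: matrix_eq)
  then show ?thesis
    by (simp add: det_mul det_mat1_plus_outer gram_lev_def v_def y_def inner_commute)
qed

lemma det_gram:
  fixes x :: "nat \<Rightarrow> real^'d"
  assumes "lam > 0"
  shows "det (gram lam x n) = lam ^ CARD('d) * (\<Prod>k<n. 1 + gram_lev lam x k)"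
proof (induction n)
  case 0
  have "gram lam x 0 = matrix ((*\<^sub>R) lam)"
    by (simp add: gram_def matrix_def mat_def vec_eq_iff axis_def)
  then show ?case by simp
next
  case (Suc n)
  then show ?case by (simp add: det_gram_Suc[OF assms])
qed

text \<open>The elliptical potential lemma: the sum is the logarithm of
  \<open>det V / lam ^ CARD('d)\<close>. Hadamard's inequality bounds it by the diagonal, whose sum
  is the trace and hence at most \<open>lam * d + n\<close>.\<close>

lemma sum_ln_gram_lev_le:
  fixes x :: "nat \<Rightarrow> real^'d"
  assumes lam: "lam > 0" and x: "\<And>t. t \<in> {1..n} \<Longrightarrow> norm (x t) \<le> 1"
  shows "(\<Sum>k<n. ln (1 + gram_lev lam x k)) \<le> real CARD('d) * ln (1 + real n / (lam * real CARD('d)))"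
proof -
  define V where "V = gram lam x n"
  define d where "d = real CARD('d)"
  \<comment> \<open>An upper bound for the average diagonal entry. The logarithm is replaced by its
    tangent at \<open>c\<close>, so only the trace matters and the linear terms sum to at most
    0.\<close>
  define c where "c = lam + real n / d"
  have d: "d > 0" by (simp add: d_def)
  have c: "c > 0" using lam d by (simp add: c_def add_pos_nonneg)
  have V_nth: "V$i$j = (if i = j then lam else 0) + (\<Sum>t=1..n. x t $ i * x t $ j)" for i j
    by (simp add: V_def gram_def mat_def outer_def)
  have Vii: "V$i$i > 0" for i
    using lam by (simp add: V_nth add_pos_nonneg sum_nonneg)
  have tr: "(\<Sum>i\<in>UNIV. V$i$i) \<le> c * d"
  proof -
    have "(\<Sum>i\<in>UNIV. V$i$i) = lam * d + (\<Sum>t=1..n. \<Sum>i\<in>UNIV. x t $ i * x t $ i)"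
      by (simp add: V_nth sum.distrib d_def) (rule sum.swap)
    also have "(\<Sum>t=1..n. \<Sum>i\<in>UNIV. x t $ i * x t $ i) = (\<Sum>t=1..n. (norm (x t))\<^sup>2)"
      by (simp add: power2_norm_eq_inner inner_vec_def)
    also have "\<dots> \<le> (\<Sum>t=1..n. 1)"
      by (intro sum_mono power_le_one) (use x in auto)
    also have "lam * d + (\<Sum>t=1..n. 1) = c * d"
      using d by (simp add: c_def distrib_right)
    finally show ?thesis by simp
  qed
  have lev_prod: "0 < (\<Prod>k<n. 1 + gram_lev lam x k)"
    by (intro prod_pos) (simp add: gram_lev_nonneg[OF lam] add_pos_nonneg)
  have "det V \<le> (\<Prod>i\<in>UNIV. V$i$i)"
  proof (rule det_le_prod_diag)
    show "V$i$j = V$j$i" for i j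
      by (simp add: V_nth mult.commute)
    show "z \<bullet> (V *v z) > 0" if "z \<noteq> 0" for z
    proof -
      have "0 < lam * (z \<bullet> z)" using that lam by simp
      also have "\<dots> \<le> z \<bullet> (V *v z)"
        unfolding V_def by (rule gram_quadratic_ge)
      finally show ?thesis .
    qed
  qed
  then have "ln (det V) \<le> ln (\<Prod>i\<in>UNIV. V$i$i)"
    using lam lev_prod Vii by (subst ln_le_cancel_iff) (auto simp: V_def det_gram intro!: prod_pos)
  also have "\<dots> = (\<Sum>i\<in>UNIV. ln (V$i$i))"
    using less_imp_neq[OF Vii, symmetric] by (intro ln_prod) simp_all
  also have "\<dots> \<le> (\<Sum>i\<in>UNIV. ln c + (V$i$i / c - 1))"
  proof (rule sum_mono)
    fix i
    have "ln (V$i$i / c) \<le> V$i$i / c - 1"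
      using Vii c by (intro ln_le_minus_one) simp
    then show "ln (V$i$i) \<le> ln c + (V$i$i / c - 1)"
      using Vii[of i] c by (simp add: ln_div)
  qed
  also have "\<dots> = d * ln c + ((\<Sum>i\<in>UNIV. V$i$i) / c - d)"
    by (simp add: sum.distrib sum_subtractf sum_divide_distrib d_def)
  also have "\<dots> \<le> d * ln c"
    using tr c by (simp add: field_simps)
  finally have "ln (det V) \<le> d * ln c" .
  moreover have "ln (\<Prod>k<n. 1 + gram_lev lam x k) = (\<Sum>k<n. ln (1 + gram_lev lam x k))"
    using less_imp_neq[OF add_pos_nonneg[OF zero_less_one gram_lev_nonneg[OF lam]], symmetric]
    by (intro ln_prod) simp_all
  then have "ln (det V) = d * ln lam + (\<Sum>k<n. ln (1 + gram_lev lam x k))"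
    using lam lev_prod by (simp add: V_def det_gram ln_mult_pos ln_realpow d_def)
  moreover have "1 + real n / (lam * d) = c / lam"
    using lam d by (simp add: c_def field_simps)
  then have "ln (1 + real n / (lam * d)) = ln c - ln lam"
    using c lam by (simp add: ln_div)
  ultimately show ?thesis
    by (simp add: d_def[symmetric] right_diff_distrib)
qed

lemma noise_sqnorm_Suc_le:
  fixes x :: "nat \<Rightarrow> real^'d" and e :: "nat \<Rightarrow> real" and n :: nat
  assumes lam: "lam > 0" and e: "\<bar>e (Suc n)\<bar> \<le> 1"
  defines "u \<equiv> gram_lev lam x n"
    and "b \<equiv> noise_sum x e n \<bullet> (gram_inv lam x n *v x (Suc n))"
  shows "noise_sqnorm lam x e (Suc n) \<le>
    noise_sqnorm lam x e n + (2 * e (Suc n) * b - b\<^sup>2) / (1 + u) + u / (1 + u)"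
proof -
  define W where "W = gram_inv lam x n"
  define v where "v = x (Suc n)"
  define y where "y = W *v v"
  define T where "T = noise_sum x e n"
  define \<epsilon> where "\<epsilon> = e (Suc n)"
  have u0: "u \<ge> 0" unfolding u_def by (rule gram_lev_nonneg[OF lam])
  have u: "u = v \<bullet> y" and b: "b = T \<bullet> y"
    by (simp_all add: u_def b_def gram_lev_def v_def y_def W_def T_def)
  have Ty: "v \<bullet> (W *v T) = b"
    unfolding b y_def W_def by (subst gram_inv_symmetric[OF lam]) (simp add: inner_commute)
  have noise: "noise_sum x e (Suc n) = T + \<epsilon> *\<^sub>R v"
    by (simp add: noise_sum_def T_def \<epsilon>_def v_def)
  have inv: "gram_inv lam x (Suc n) *v z = W *v z - ((y \<bullet> z) / (1 + u)) *\<^sub>R y" for z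
    by (simp add: gram_inv_Suc_mult_vec W_def v_def y_def u)
  \<comment> \<open>The new summand of \<open>T\<close> contributes
    \<open>2 * \<epsilon> * b + \<epsilon>\<^sup>2 * u\<close> in the old metric; the last fraction
    is the effect of updating the inverse.\<close>
  have "noise_sqnorm lam x e (Suc n) =
     T \<bullet> (W *v T) + 2 * \<epsilon> * b + \<epsilon>\<^sup>2 * u - (b + \<epsilon> * u)\<^sup>2 / (1 + u)"
    unfolding noise_sqnorm_def noise inv
    by (simp add: inner_add_left inner_add_right inner_diff_right matrix_vector_right_distrib
        matrix_vector_mult_scaleR y_def[symmetric] Ty u[symmetric] b[symmetric]
        inner_commute[of y] power2_eq_square algebra_simps add_divide_distrib)
  also have "\<dots> = T \<bullet> (W *v T) + (2 * \<epsilon> * b - b\<^sup>2) / (1 + u) + \<epsilon>\<^sup>2 * u / (1 + u)"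
    using u0 by (simp add: divide_simps add_eq_0_iff) (simp add: power2_eq_square algebra_simps)
  also have "\<epsilon>\<^sup>2 * u / (1 + u) \<le> u / (1 + u)"
    using u0 e abs_square_le_1[of \<epsilon>] by (intro divide_right_mono mult_left_le_one_le) (auto simp: \<epsilon>_def)
  finally show ?thesis
    by (simp add: noise_sqnorm_def T_def W_def \<epsilon>_def)
qed

subsection \<open>Self-normalised concentration\<close>

text \<open>Hoeffding's bound for a centred Bernoulli variable with mean \<open>q\<close>. Negative
  \<open>l\<close> reduces to positive \<open>l\<close> by exchanging the two outcomes, that is
  \<open>q\<close> with \<open>1 - q\<close>.\<close>

lemma Bernoulli_mgf_le:
  fixes q l :: real
  assumes "0 \<le> q" "q \<le> 1"
  shows "(1 - q) * exp (- l * q) + q * exp (l * (1 - q)) \<le> exp (l\<^sup>2 / 8)"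
proof -
  have *: "(1 - q) * exp (- l * q) + q * exp (l * (1 - q)) \<le> exp (l\<^sup>2 / 8)"
    if "0 \<le> q" "q \<le> 1" "0 \<le> l" for q l :: real
  proof -
    have "q * (exp l - 1) \<ge> 0"
      using that by simp
    then have pos: "1 + q * (exp l - 1) > 0"
      by linarith
    have "(1 - q) * exp (- l * q) + q * exp (l * (1 - q)) = exp (- l * q) * (1 + q * (exp l - 1))"
      by (simp add: algebra_simps exp_diff exp_minus divide_inverse)
    also have "\<dots> = exp (- l * q + ln (1 + q * (exp l - 1)))"
      using pos by (simp only: exp_add exp_ln)
    also have "\<dots> \<le> exp (l\<^sup>2 / 8)"
      using Hoeffdings_lemma_aux[OF that(3,1)] by simp
    finally show ?thesis .
  qed
  show ?thesis
  proof (cases "l \<ge> 0")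
    case True
    then show ?thesis using * assms by blast
  next
    case False
    then show ?thesis using *[of "1 - q" "- l"] assms by (simp add: algebra_simps)
  qed
qed

text \<open>Convexity of \<open>exp\<close>. The chord is affine in \<open>X\<close>, so its
  conditional expectation depends on the conditional mean of \<open>X\<close> alone.\<close>

lemma exp_mult_le_chord:
  fixes X q l :: real
  assumes "0 \<le> X" "X \<le> 1"
  shows "exp (l * (X - q)) \<le> (1 - X) * exp (- l * q) + X * exp (l * (1 - q))"
proof -
  have "exp ((1 - X) *\<^sub>R (- l * q) + X *\<^sub>R (l * (1 - q))) \<le> (1 - X) * exp (- l * q) + X * exp (l * (1 - q))"
    by (rule convex_onD[OF convex_on_exp[of 1, simplified]]) (use assms in auto)
  then show ?thesis by (simp add: algebra_simps)
qed

text \<open>Passes to the nonnegative conditional expectation, from which measurable factors can be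
  pulled out without any integrability condition.\<close>

lemma (in sigma_finite_subalgebra) nn_cond_exp_eq_real_cond_exp:
  fixes X q :: "'a \<Rightarrow> real"
  assumes int: "integrable M X" "integrable M q"
    and nn: "\<And>x. x \<in> space M \<Longrightarrow> 0 \<le> X x" "\<And>x. x \<in> space M \<Longrightarrow> 0 \<le> q x"
    and q: "q \<in> borel_measurable F"
    and eq: "AE x in M. real_cond_exp M F X x = q x"
  shows "AE x in M. ennreal (q x) = nn_cond_exp M F (\<lambda>x. ennreal (X x)) x"
proof (rule nn_cond_exp_charact)
  fix A assume A: "A \<in> sets F"
  then have AM: "A \<in> sets M"
    using subalg by (auto simp: subalgebra_def)
  have *: "(\<integral>\<^sup>+ x\<in>A. ennreal (f x) \<partial>M) = ennreal (\<integral>x\<in>A. f x \<partial>M)"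
    if "integrable M f" "\<And>x. x \<in> space M \<Longrightarrow> 0 \<le> f x" for f :: "'a \<Rightarrow> real"
  proof -
    have "(\<integral>\<^sup>+ x\<in>A. ennreal (f x) \<partial>M) = (\<integral>\<^sup>+ x. ennreal (indicator A x *\<^sub>R f x) \<partial>M)"
      by (intro nn_integral_cong) (simp split: split_indicator)
    also have "\<dots> = ennreal (\<integral>x. indicator A x *\<^sub>R f x \<partial>M)"
      using that AM by (intro nn_integral_eq_integral integrable_mult_indicator) auto
    finally show ?thesis by (simp add: set_lebesgue_integral_def)
  qed
  have "(\<integral>x\<in>A. X x \<partial>M) = (\<integral>x\<in>A. real_cond_exp M F X x \<partial>M)"
    by (rule real_cond_exp_intA[OF int(1) A])
  also have "\<dots> = (\<integral>x\<in>A. q x \<partial>M)"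
    using eq AM measurable_from_subalg[OF subalg q] unfolding set_lebesgue_integral_def
    by (intro integral_cong_AE) auto
  finally show "(\<integral>\<^sup>+ x\<in>A. ennreal (X x) \<partial>M) = (\<integral>\<^sup>+ x\<in>A. ennreal (q x) \<partial>M)"
    using * int nn by simp
qed (use int q in auto)

text \<open>The exponential is replaced by its chord, conditioning turns \<open>X\<close> into
  \<open>q\<close>, and the Bernoulli bound finishes. \<open>Y\<close> and \<open>l\<close> may be
  unbounded, hence the nonnegative integrals.\<close>

lemma conditional_Hoeffding:
  fixes X q Y l :: "'w \<Rightarrow> real"
  assumes M: "prob_space M" and sub: "subalgebra M G"
    and X: "X \<in> borel_measurable M" "\<And>x. x \<in> space M \<Longrightarrow> 0 \<le> X x \<and> X x \<le> 1"
    and q: "q \<in> borel_measurable G" "\<And>x. x \<in> space M \<Longrightarrow> 0 \<le> q x \<and> q x \<le> 1"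
    and eq: "AE x in M. real_cond_exp M G X x = q x"
    and Y: "Y \<in> borel_measurable G" "\<And>x. x \<in> space M \<Longrightarrow> 0 \<le> Y x"
    and l: "l \<in> borel_measurable G"
  shows "(\<integral>\<^sup>+ x. ennreal (Y x * exp (l x * (X x - q x))) \<partial>M) \<le> (\<integral>\<^sup>+ x. ennreal (Y x * exp ((l x)\<^sup>2 / 8)) \<partial>M)"
proof -
  interpret prob_space M by fact
  interpret finite_measure_subalgebra M G
    by unfold_locales (fact sub)
  note [measurable] = X(1) q(1) Y(1) l
  have [measurable]: "q \<in> borel_measurable M" "Y \<in> borel_measurable M" "l \<in> borel_measurable M"
    by (rule measurable_from_subalg[OF sub], fact)+
  have int: "integrable M X" "integrable M q"
    using X q by (auto intro!: integrable_const_bound[of _ 1] AE_I2)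
  have 1: "AE x in M. ennreal (q x) = nn_cond_exp M G (\<lambda>x. ennreal (X x)) x"
    using X q by (intro nn_cond_exp_eq_real_cond_exp int eq) auto
  have "AE x in M. real_cond_exp M G (\<lambda>x. 1 - X x) x = real_cond_exp M G (\<lambda>x. 1) x - real_cond_exp M G X x"
    by (intro real_cond_exp_diff int) auto
  moreover have "AE x in M. real_cond_exp M G (\<lambda>x. 1) x = 1"
    by (rule real_cond_exp_F_meas) auto
  ultimately have "AE x in M. real_cond_exp M G (\<lambda>x. 1 - X x) x = 1 - q x"
    using eq by eventually_elim auto
  then have 2: "AE x in M. ennreal (1 - q x) = nn_cond_exp M G (\<lambda>x. ennreal (1 - X x)) x"
    using X q int by (intro nn_cond_exp_eq_real_cond_exp) auto
  \<comment> \<open>Conditioning on \<open>G\<close> under the integral, against a weight known to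
    \<open>G\<close>.\<close>
  have pull: "(\<integral>\<^sup>+ x. f x * ennreal (A x) \<partial>M) = (\<integral>\<^sup>+ x. f x * ennreal (B x) \<partial>M)"
    if "AE x in M. ennreal (B x) = nn_cond_exp M G (\<lambda>x. ennreal (A x)) x"
      "f \<in> borel_measurable G" "A \<in> borel_measurable M" for A B :: "'w \<Rightarrow> real" and f
  proof -
    have "(\<integral>\<^sup>+ x. f x * ennreal (A x) \<partial>M) = (\<integral>\<^sup>+ x. f x * nn_cond_exp M G (\<lambda>x. ennreal (A x)) x \<partial>M)"
      using that by (intro nn_cond_exp_intg[symmetric]) auto
    also have "\<dots> = (\<integral>\<^sup>+ x. f x * ennreal (B x) \<partial>M)"
      using that(1) by (intro nn_integral_cong_AE) auto
    finally show ?thesis .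
  qed
  define f where "f x = ennreal (Y x * exp (- l x * q x))" for x
  define g where "g x = ennreal (Y x * exp (l x * (1 - q x)))" for x
  have [measurable]: "f \<in> borel_measurable G" "g \<in> borel_measurable G"
    unfolding f_def g_def by measurable
  have [measurable]: "f \<in> borel_measurable M" "g \<in> borel_measurable M"
    unfolding f_def g_def by measurable
  have "(\<integral>\<^sup>+ x. ennreal (Y x * exp (l x * (X x - q x))) \<partial>M)
     \<le> (\<integral>\<^sup>+ x. f x * ennreal (1 - X x) + g x * ennreal (X x) \<partial>M)"
  proof (rule nn_integral_mono)
    fix x assume x: "x \<in> space M"
    have "Y x * exp (l x * (X x - q x)) \<le> Y x * ((1 - X x) * exp (- l x * q x) + X x * exp (l x * (1 - q x)))"
      using X Y x by (intro mult_left_mono exp_mult_le_chord) auto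
    also have "\<dots> = (Y x * exp (- l x * q x)) * (1 - X x) + (Y x * exp (l x * (1 - q x))) * X x"
      by (simp add: algebra_simps)
    finally show "ennreal (Y x * exp (l x * (X x - q x))) \<le> f x * ennreal (1 - X x) + g x * ennreal (X x)"
      using X(2)[OF x] Y(2)[OF x] unfolding f_def g_def
      by (simp add: ennreal_mult[symmetric] ennreal_plus[symmetric] ennreal_leI del: ennreal_plus)
  qed
  also have "\<dots> = (\<integral>\<^sup>+ x. f x * ennreal (1 - X x) \<partial>M) + (\<integral>\<^sup>+ x. g x * ennreal (X x) \<partial>M)"
    by (rule nn_integral_add) auto
  also have "\<dots> = (\<integral>\<^sup>+ x. f x * ennreal (1 - q x) \<partial>M) + (\<integral>\<^sup>+ x. g x * ennreal (q x) \<partial>M)"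
    by (subst pull[OF 2] pull[OF 1]; measurable)+
  also have "\<dots> = (\<integral>\<^sup>+ x. f x * ennreal (1 - q x) + g x * ennreal (q x) \<partial>M)"
    by (rule nn_integral_add[symmetric]) auto
  also have "\<dots> \<le> (\<integral>\<^sup>+ x. ennreal (Y x * exp ((l x)\<^sup>2 / 8)) \<partial>M)"
  proof (rule nn_integral_mono)
    fix x assume x: "x \<in> space M"
    have "(Y x * exp (- l x * q x)) * (1 - q x) + (Y x * exp (l x * (1 - q x))) * q x
      = Y x * ((1 - q x) * exp (- l x * q x) + q x * exp (l x * (1 - q x)))"
      by (simp add: algebra_simps)
    also have "\<dots> \<le> Y x * exp ((l x)\<^sup>2 / 8)"
      using q Y x by (intro mult_left_mono Bernoulli_mgf_le) auto
    finally show "f x * ennreal (1 - q x) + g x * ennreal (q x) \<le> ennreal (Y x * exp ((l x)\<^sup>2 / 8))"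
      using q(2)[OF x] Y(2)[OF x] unfolding f_def g_def
      by (simp add: ennreal_mult[symmetric] ennreal_plus[symmetric] ennreal_leI del: ennreal_plus)
  qed
  finally show ?thesis .
qed

section \<open>Measurability of the Gram inverse and the noise vector in the data\<close>

lemma borel_measurable_matrix_vector_mult [measurable (raw)]:
  fixes f :: "'w \<Rightarrow> real^'n^'m"
  assumes "f \<in> borel_measurable M" "g \<in> borel_measurable M"
  shows "(\<lambda>x. f x *v g x) \<in> borel_measurable M"
  using assms
  by (rule borel_measurable_continuous_Pair)
    (auto simp: matrix_vector_mult_def intro!: continuous_intros)

lemma borel_measurable_outer [measurable (raw)]:
  assumes "f \<in> borel_measurable M" "g \<in> borel_measurable M"
  shows "(\<lambda>x. outer (f x) (g x)) \<in> borel_measurable M"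
  using assms
  by (rule borel_measurable_continuous_Pair)
    (auto simp: outer_def intro!: continuous_intros)

lemma borel_measurable_gram_inv:
  assumes "\<And>t. t \<in> {1..n} \<Longrightarrow> x t \<in> borel_measurable M"
  shows "(\<lambda>w. gram_inv lam (\<lambda>t. x t w) n) \<in> borel_measurable M"
  using assms
proof (induction n)
  case 0
  then show ?case by simp
next
  case (Suc n)
  then have [measurable]: "(\<lambda>w. gram_inv lam (\<lambda>t. x t w) n) \<in> borel_measurable M" "x (Suc n) \<in> borel_measurable M"
    by auto
  show ?case
    unfolding gram_inv.simps by measurable
qed

lemma borel_measurable_noise_sum:
  assumes "\<And>t. t \<in> {1..n} \<Longrightarrow> x t \<in> borel_measurable M" "\<And>t. t \<in> {1..n} \<Longrightarrow> e t \<in> borel_measurable M"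
  shows "(\<lambda>w. noise_sum (\<lambda>t. x t w) (\<lambda>t. e t w) n) \<in> borel_measurable M"
  unfolding noise_sum_def using assms by (intro borel_measurable_sum borel_measurable_scaleR) auto

text \<open>\<open>G t\<close> must know the features up to and including time \<open>t\<close>, but
  the responses \<open>X\<close> only before \<open>t\<close>. The noise at time \<open>t\<close> is
  then centred given everything else that enters the update of \<open>Z\<close>.\<close>

lemma self_normalized_bound:
  fixes x :: "nat \<Rightarrow> 'w \<Rightarrow> real^'d" and X q :: "nat \<Rightarrow> 'w \<Rightarrow> real"
  assumes M: "prob_space M" and sub: "\<And>t. t \<in> {1..N} \<Longrightarrow> subalgebra M (G t)"
    and x: "\<And>t i. t \<in> {1..N} \<Longrightarrow> i \<in> {1..t} \<Longrightarrow> x i \<in> borel_measurable (G t)"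
    and hist: "\<And>t i. t \<in> {1..N} \<Longrightarrow> i \<in> {1..<t} \<Longrightarrow> X i \<in> borel_measurable (G t)"
    and q: "\<And>t i. t \<in> {1..N} \<Longrightarrow> i \<in> {1..t} \<Longrightarrow> q i \<in> borel_measurable (G t)"
    and X: "\<And>t. t \<in> {1..N} \<Longrightarrow> X t \<in> borel_measurable M"
    and X01: "\<And>t w. t \<in> {1..N} \<Longrightarrow> w \<in> space M \<Longrightarrow> 0 \<le> X t w \<and> X t w \<le> 1"
    and q01: "\<And>t w. t \<in> {1..N} \<Longrightarrow> w \<in> space M \<Longrightarrow> 0 \<le> q t w \<and> q t w \<le> 1"
    and eq: "\<And>t. t \<in> {1..N} \<Longrightarrow> AE w in M. real_cond_exp M (G t) (X t) w = q t w"
    and xbd: "\<And>t w. t \<in> {1..N} \<Longrightarrow> w \<in> space M \<Longrightarrow> norm (x t w) \<le> 1"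
    and lam: "lam > 0" and \<delta>: "\<delta> > 0"
  shows "\<exists>E\<in>sets M. measure M E \<ge> 1 - \<delta> \<and>
    (\<forall>w\<in>E. noise_sqnorm lam (\<lambda>t. x t w) (\<lambda>t. X t w - q t w) N \<le>
      real CARD('d) * ln (1 + real N / (lam * real CARD('d))) + ln (1 / \<delta>) / 2)"
proof -
  interpret prob_space M by fact
  define Z where "Z n w = noise_sqnorm lam (\<lambda>t. x t w) (\<lambda>t. X t w - q t w) n" for n w
  define u where "u n w = gram_lev lam (\<lambda>t. x t w) n" for n w
  define D where "D n w = (\<Sum>k<n. u k w / (1 + u k w))" for n w
  define \<psi> where "\<psi> n w = exp (2 * Z n w - 2 * D n w)" for n w
  have u0: "u n w \<ge> 0" for n w
    unfolding u_def by (rule gram_lev_nonneg[OF lam])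
  \<comment> \<open>Stated for any sigma-algebra \<open>B\<close>, since the same quantities are
    needed as measurable for \<open>G (Suc n)\<close> and for \<open>M\<close>.\<close>
  have meas_gen: "Z n \<in> borel_measurable B" "D n \<in> borel_measurable B" "\<psi> n \<in> borel_measurable B"
    if "\<And>t. t \<in> {1..n} \<Longrightarrow> x t \<in> borel_measurable B" "\<And>t. t \<in> {1..n} \<Longrightarrow> X t \<in> borel_measurable B"
      "\<And>t. t \<in> {1..n} \<Longrightarrow> q t \<in> borel_measurable B" for n B
  proof -
    have [measurable]: "(\<lambda>w. gram_inv lam (\<lambda>t. x t w) n) \<in> borel_measurable B"
      using that by (intro borel_measurable_gram_inv) auto
    have [measurable]: "(\<lambda>w. noise_sum (\<lambda>t. x t w) (\<lambda>t. X t w - q t w) n) \<in> borel_measurable B"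
      using that by (intro borel_measurable_noise_sum borel_measurable_diff) auto
    show Z[measurable]: "Z n \<in> borel_measurable B"
      unfolding Z_def noise_sqnorm_def by measurable
    have u[measurable]: "u k \<in> borel_measurable B" if "k < n" for k
    proof -
      have [measurable]: "(\<lambda>w. gram_inv lam (\<lambda>t. x t w) k) \<in> borel_measurable B" "x (Suc k) \<in> borel_measurable B"
        using that \<open>\<And>t. t \<in> {1..n} \<Longrightarrow> x t \<in> borel_measurable B\<close>
        by (auto intro!: borel_measurable_gram_inv)
      show ?thesis
        unfolding u_def gram_lev_def by measurable
    qed
    show D[measurable]: "D n \<in> borel_measurable B"
      unfolding D_def using u by (intro borel_measurable_sum borel_measurable_divide borel_measurable_add) auto
    show "\<psi> n \<in> borel_measurable B"
      unfolding \<psi>_def by measurable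
  qed
  have main: "(\<integral>\<^sup>+ w. ennreal (\<psi> n w) \<partial>M) \<le> 1" if "n \<le> N" for n
    using that
  proof (induction n)
    case 0
    have "\<psi> 0 w = 1" for w
      by (simp add: \<psi>_def Z_def D_def noise_sqnorm_def noise_sum_def)
    then show ?case by (simp add: emeasure_space_1)
  next
    case (Suc n)
    define t where "t = Suc n"
    have t: "t \<in> {1..N}" using Suc by (simp add: t_def)
    define b where "b w = noise_sum (\<lambda>t. x t w) (\<lambda>t. X t w - q t w) n \<bullet> (gram_inv lam (\<lambda>t. x t w) n *v x t w)" for w
    \<comment> \<open>\<open>l\<close> is the coefficient of the centred noise in the exponent and
      \<open>Y\<close> the part known to \<open>G t\<close>. Hoeffding costs
      \<open>l\<^sup>2 / 8 = 2 * b\<^sup>2 / (1 + u)\<^sup>2\<close>, which the factor in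
      \<open>Y\<close> pays for because \<open>u \<ge> 0\<close>. The 2 in the exponent of
      \<open>\<psi>\<close> is the largest factor for which this works at every such
      \<open>u\<close>.\<close>
    define l where "l w = 4 * b w / (1 + u n w)" for w
    define Y where "Y w = \<psi> n w * exp (- 2 * (b w)\<^sup>2 / (1 + u n w))" for w
    have [measurable]: "x t \<in> borel_measurable (G t)"
      using x[OF t, of t] t by auto
    have [measurable]: "(\<lambda>w. gram_inv lam (\<lambda>t. x t w) n) \<in> borel_measurable (G t)"
      using x[OF t] by (intro borel_measurable_gram_inv) (auto simp: t_def)
    have [measurable]: "(\<lambda>w. noise_sum (\<lambda>t. x t w) (\<lambda>t. X t w - q t w) n) \<in> borel_measurable (G t)"
      using x[OF t] q[OF t] hist[OF t]
      by (intro borel_measurable_noise_sum borel_measurable_diff) (auto simp: t_def)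
    have [measurable]: "u n \<in> borel_measurable (G t)"
      unfolding u_def gram_lev_def t_def[symmetric] by measurable
    have [measurable]: "b \<in> borel_measurable (G t)"
      unfolding b_def by measurable
    have [measurable]: "l \<in> borel_measurable (G t)"
      unfolding l_def by measurable
    have [measurable]: "\<psi> n \<in> borel_measurable (G t)"
      using x[OF t] q[OF t] hist[OF t] by (intro meas_gen) (auto simp: t_def)
    have [measurable]: "Y \<in> borel_measurable (G t)"
      unfolding Y_def by measurable
    have Y0: "0 \<le> Y w" for w
      by (simp add: Y_def \<psi>_def)
    have "(\<integral>\<^sup>+ w. ennreal (\<psi> t w) \<partial>M) \<le> (\<integral>\<^sup>+ w. ennreal (Y w * exp (l w * (X t w - q t w))) \<partial>M)"
    proof (intro nn_integral_mono ennreal_leI)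
      fix w assume w: "w \<in> space M"
      have "Z t w \<le> Z n w + (2 * (X t w - q t w) * b w - (b w)\<^sup>2) / (1 + u n w) + u n w / (1 + u n w)"
        unfolding Z_def t_def u_def b_def
        using X01[OF t w] q01[OF t w] by (intro noise_sqnorm_Suc_le[OF lam]) (auto simp: t_def)
      moreover have "D t w = D n w + u n w / (1 + u n w)"
        by (simp add: D_def t_def)
      ultimately have "2 * Z t w - 2 * D t w \<le>
          (2 * Z n w - 2 * D n w) + 2 * ((2 * (X t w - q t w) * b w - (b w)\<^sup>2) / (1 + u n w))"
        by linarith
      also have "\<dots> = (2 * Z n w - 2 * D n w) + (- 2 * (b w)\<^sup>2 / (1 + u n w)) + l w * (X t w - q t w)"
        by (simp add: l_def diff_divide_distrib add_divide_distrib algebra_simps)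
      finally show "\<psi> t w \<le> Y w * exp (l w * (X t w - q t w))"
        unfolding Y_def \<psi>_def exp_add[symmetric] by simp
    qed
    also have "\<dots> \<le> (\<integral>\<^sup>+ w. ennreal (Y w * exp ((l w)\<^sup>2 / 8)) \<partial>M)"
      using t q[OF t, of t] by (intro conditional_Hoeffding[OF M sub[OF t] X X01 _ q01 eq]) (auto simp: Y0)
    also have "\<dots> \<le> (\<integral>\<^sup>+ w. ennreal (\<psi> n w) \<partial>M)"
    proof (intro nn_integral_mono ennreal_leI)
      fix w
      have "(l w)\<^sup>2 / 8 = 2 * (b w)\<^sup>2 / (1 + u n w) / (1 + u n w)"
        by (simp add: l_def power2_eq_square)
      also have "\<dots> \<le> 2 * (b w)\<^sup>2 / (1 + u n w) / 1"
        using u0[of n w] by (intro divide_left_mono) auto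
      finally have "exp (- 2 * (b w)\<^sup>2 / (1 + u n w) + (l w)\<^sup>2 / 8) \<le> 1"
        by simp
      then have "\<psi> n w * exp (- 2 * (b w)\<^sup>2 / (1 + u n w) + (l w)\<^sup>2 / 8) \<le> \<psi> n w * 1"
        by (intro mult_left_mono) (auto simp: \<psi>_def)
      then show "Y w * exp ((l w)\<^sup>2 / 8) \<le> \<psi> n w"
        unfolding Y_def exp_add by (simp only: mult.assoc mult_1_right)
    qed
    also have "\<dots> \<le> 1"
      using Suc by simp
    finally show ?case by (simp add: t_def)
  qed
  have [measurable]: "\<psi> N \<in> borel_measurable M"
    using X measurable_from_subalg[OF sub x] measurable_from_subalg[OF sub q]
    by (intro meas_gen) fastforce+
  \<comment> \<open>The failure event \<open>\<psi> N \<ge> 1 / \<delta>\<close>, in the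
    multiplicative form of Markov's inequality.\<close>
  define B where "B = {w \<in> space M. 1 \<le> ennreal \<delta> * ennreal (\<psi> N w)}"
  have [measurable]: "B \<in> sets M"
    unfolding B_def by measurable
  have "emeasure M B \<le> ennreal \<delta> * (\<integral>\<^sup>+ w. ennreal (\<psi> N w) * indicator (space M) w \<partial>M)"
    using nn_integral_Markov_inequality[of "\<lambda>w. ennreal (\<psi> N w)" "space M" M "ennreal \<delta>"]
    by (simp add: B_def)
  also have "\<dots> = ennreal \<delta> * (\<integral>\<^sup>+ w. ennreal (\<psi> N w) \<partial>M)"
    by (intro arg_cong[where f = "(*) (ennreal \<delta>)"] nn_integral_cong) simp
  also have "\<dots> \<le> ennreal \<delta> * 1"
    by (intro mult_left_mono main) auto
  finally have "prob B \<le> \<delta>"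
    using \<delta> by (simp add: emeasure_eq_measure)
  then have "prob (space M - B) \<ge> 1 - \<delta>"
    by (simp add: prob_compl)
  moreover have "Z N w \<le> real CARD('d) * ln (1 + real N / (lam * real CARD('d))) + ln (1 / \<delta>) / 2"
    if w: "w \<in> space M - B" for w
  proof -
    have "\<delta> * \<psi> N w < 1"
      using w \<delta> unfolding B_def by (auto simp: ennreal_mult[symmetric] \<psi>_def not_le ennreal_less_one_iff)
    then have "\<psi> N w < 1 / \<delta>"
      using \<delta> by (simp add: field_simps)
    then have "ln (\<psi> N w) < ln (1 / \<delta>)"
      using \<delta> by (subst ln_less_cancel_iff) (auto simp: \<psi>_def)
    then have "2 * Z N w - 2 * D N w < ln (1 / \<delta>)"
      by (simp add: \<psi>_def)
    moreover have "D N w \<le> (\<Sum>k<N. ln (1 + u k w))"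
      unfolding D_def
    proof (rule sum_mono)
      fix k
      \<comment> \<open>The inequality \<open>ln y \<le> y - 1\<close> at
        \<open>y = 1 / (1 + u)\<close>.\<close>
      have "ln (1 / (1 + u k w)) \<le> 1 / (1 + u k w) - 1"
        using u0[of k w] by (intro ln_le_minus_one) auto
      moreover have "1 / (1 + u k w) - 1 = - (u k w / (1 + u k w))"
        using u0[of k w] by (simp add: field_simps)
      ultimately show "u k w / (1 + u k w) \<le> ln (1 + u k w)"
        using u0[of k w] by (simp add: ln_div)
    qed
    moreover have "(\<Sum>k<N. ln (1 + u k w)) \<le> real CARD('d) * ln (1 + real N / (lam * real CARD('d)))"
      unfolding u_def using xbd w by (intro sum_ln_gram_lev_le[OF lam]) auto
    ultimately show ?thesis by linarith
  qed
  ultimately show ?thesis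
    unfolding Z_def by (intro bexI[of _ "space M - B"]) auto
qed

subsection \<open>Fitted evaluation in the linear Markov decision process\<close>

text \<open>The hypothesis describes the conditional law of \<open>s'\<close> on events only. To
  reach integrals of \<open>V\<close>, an equality of measures is derived on each \<open>A\<close>
  in \<open>G\<close>, and both sides are integrated.\<close>

lemma cond_exp_kernel:
  fixes V :: "'s \<Rightarrow> real"
  assumes M: "prob_space M" and sub: "subalgebra M G"
    and K: "K \<in> G \<rightarrow>\<^sub>M prob_algebra S" and s': "s' \<in> M \<rightarrow>\<^sub>M S"
    and cond: "\<And>B. B \<in> sets S \<Longrightarrow> AE x in M.
      real_cond_exp M G (indicator {y \<in> space M. s' y \<in> B}) x = measure (K x) B"
    and V: "V \<in> borel_measurable S" "\<And>y. y \<in> space S \<Longrightarrow> 0 \<le> V y \<and> V y \<le> C"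
  shows "AE x in M. real_cond_exp M G (\<lambda>x. V (s' x)) x = (\<integral>y. V y \<partial>K x)"
proof -
  interpret prob_space M by fact
  interpret finite_measure_subalgebra M G
    by unfold_locales (fact sub)
  note [measurable] = s' V(1)
  have KG[measurable]: "K \<in> G \<rightarrow>\<^sub>M subprob_algebra S"
    using K by (rule measurable_prob_algebraD)
  have KM[measurable]: "K \<in> M \<rightarrow>\<^sub>M subprob_algebra S"
    using measurable_from_subalg[OF sub KG] .
  have spG: "space G = space M" using sub by (simp add: subalgebra_def)
  have Kx: "prob_space (K x)" "sets (K x) = sets S" "space (K x) = space S" if "x \<in> space M" for x
    using measurable_space[OF K, of x] that spG
    by (auto simp: space_prob_algebra dest: sets_eq_imp_space_eq)
  have s'_sp: "s' x \<in> space S" if "x \<in> space M" for x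
    using measurable_space[OF s' that] .
  have intK: "integrable (K x) V" if "x \<in> space M" for x
  proof -
    interpret K: prob_space "K x" using Kx that by auto
    show ?thesis
      using V Kx[OF that]
      by (intro K.integrable_const_bound[of _ C] AE_I2) (auto simp: cong: measurable_cong_sets)
  qed
  have K_bd: "0 \<le> (\<integral>y. V y \<partial>K x) \<and> (\<integral>y. V y \<partial>K x) \<le> C" if "x \<in> space M" for x
  proof -
    interpret K: prob_space "K x" using Kx that by auto
    show ?thesis
      using V Kx[OF that] intK[OF that]
      by (auto intro!: Bochner_Integration.integral_nonneg_AE AE_I2 K.integral_le_const)
  qed
  have IG[measurable]: "(\<lambda>x. \<integral>y. V y \<partial>K x) \<in> borel_measurable G"
    by measurable
  have [measurable]: "(\<lambda>x. \<integral>y. V y \<partial>K x) \<in> borel_measurable M"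
    by measurable
  have int1: "integrable M (\<lambda>x. V (s' x))"
    using V s'_sp by (intro integrable_const_bound[of _ C] AE_I2) auto
  have int2: "integrable M (\<lambda>x. \<integral>y. V y \<partial>K x)"
    using K_bd by (intro integrable_const_bound[of _ C] AE_I2) auto
  have ne: "space M \<noteq> {}" by (rule not_empty)
  have key: "(\<integral>\<^sup>+ x. indicator A x * ennreal (V (s' x)) \<partial>M) = (\<integral>\<^sup>+ x. indicator A x * (\<integral>\<^sup>+ y. ennreal (V y) \<partial>K x) \<partial>M)"
    if A[measurable]: "A \<in> sets G" for A
  proof -
    have [measurable]: "A \<in> sets M"
      using A sub by (auto simp: subalgebra_def)
    define D where "D = density M (indicator A)"
    have [measurable_cong]: "sets D = sets M" by (simp add: D_def)
    have spD: "space D = space M" by (simp add: D_def)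
    \<comment> \<open>On the event \<open>A\<close>, the law of \<open>s'\<close> is the mixture of
      the kernels \<open>K x\<close>. Both measures agree on each \<open>B\<close>, by the
      hypothesis for the indicator of \<open>J\<close>.\<close>
    have "distr D S s' = D \<bind> K"
    proof (rule measure_eqI)
      show "sets (distr D S s') = sets (D \<bind> K)"
        using ne spD by (subst sets_bind_measurable[of _ _ S]) auto
      fix B assume "B \<in> sets (distr D S s')"
      then have B[measurable]: "B \<in> sets S" by simp
      define J where "J = {y \<in> space M. s' y \<in> B}"
      have [measurable]: "J \<in> sets M" unfolding J_def by measurable
      have nn: "AE x in M. ennreal (measure (K x) B) = nn_cond_exp M G (\<lambda>x. ennreal (indicator J x)) x"
      proof (rule nn_cond_exp_eq_real_cond_exp)
        show mB: "(\<lambda>x. measure (K x) B) \<in> borel_measurable G" by measurable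
        show "integrable M (\<lambda>x. measure (K x) B)"
        proof (intro integrable_const_bound[of _ 1] AE_I2)
          show "norm (measure (K x) B) \<le> 1" if "x \<in> space M" for x
            using prob_space.prob_le_1[OF Kx(1)[OF that], of B] by simp
        qed measurable
        show "AE x in M. real_cond_exp M G (indicator J) x = measure (K x) B"
          unfolding J_def by (rule cond[OF B])
      qed (auto simp: less_top[symmetric])
      have "emeasure (distr D S s') B = emeasure D J"
        by (subst emeasure_distr) (auto simp: spD J_def vimage_def Int_def conj_commute)
      also have "\<dots> = (\<integral>\<^sup>+ x. indicator A x * ennreal (indicator J x) \<partial>M)"
        unfolding D_def by (subst emeasure_density) (auto simp: ennreal_indicator)
      also have "\<dots> = (\<integral>\<^sup>+ x. indicator A x * nn_cond_exp M G (\<lambda>x. ennreal (indicator J x)) x \<partial>M)"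
        by (rule nn_cond_exp_intg[symmetric]) auto
      also have "\<dots> = (\<integral>\<^sup>+ x. indicator A x * ennreal (measure (K x) B) \<partial>M)"
        using nn by (intro nn_integral_cong_AE) auto
      also have "\<dots> = (\<integral>\<^sup>+ x. indicator A x * emeasure (K x) B \<partial>M)"
        by (intro nn_integral_cong) (simp add: finite_measure.emeasure_eq_measure[OF prob_space.finite_measure[OF Kx(1)]])
      also have "\<dots> = (\<integral>\<^sup>+ x. emeasure (K x) B \<partial>D)"
        unfolding D_def by (subst nn_integral_density) auto
      also have "\<dots> = emeasure (D \<bind> K) B"
        using ne spD by (subst emeasure_bind[of _ _ S]) auto
      finally show "emeasure (distr D S s') B = emeasure (D \<bind> K) B" .
    qed
    then have "(\<integral>\<^sup>+ y. ennreal (V y) \<partial>distr D S s') = (\<integral>\<^sup>+ y. ennreal (V y) \<partial>(D \<bind> K))"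
      by simp
    also have "(\<integral>\<^sup>+ y. ennreal (V y) \<partial>distr D S s') = (\<integral>\<^sup>+ x. ennreal (V (s' x)) \<partial>D)"
      by (rule nn_integral_distr) auto
    also have "(\<integral>\<^sup>+ y. ennreal (V y) \<partial>(D \<bind> K)) = (\<integral>\<^sup>+ x. \<integral>\<^sup>+ y. ennreal (V y) \<partial>K x \<partial>D)"
      by (rule nn_integral_bind[of _ S]) auto
    finally show ?thesis
      unfolding D_def by (simp add: nn_integral_density)
  qed
  show ?thesis
  proof (rule real_cond_exp_charact[OF _ int1 int2 IG])
    fix A assume A[measurable]: "A \<in> sets G"
    have [measurable]: "A \<in> sets M"
      using A sub by (auto simp: subalgebra_def)
    have "(\<integral>x\<in>A. V (s' x) \<partial>M) = enn2real (\<integral>\<^sup>+ x. ennreal (indicator A x *\<^sub>R V (s' x)) \<partial>M)"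
      unfolding set_lebesgue_integral_def
      using V s'_sp by (intro integral_eq_nn_integral AE_I2) auto
    also have "(\<integral>\<^sup>+ x. ennreal (indicator A x *\<^sub>R V (s' x)) \<partial>M) = (\<integral>\<^sup>+ x. indicator A x * ennreal (V (s' x)) \<partial>M)"
      by (intro nn_integral_cong) (simp split: split_indicator)
    also have "\<dots> = (\<integral>\<^sup>+ x. indicator A x * (\<integral>\<^sup>+ y. ennreal (V y) \<partial>K x) \<partial>M)"
      by (rule key) fact
    also have "\<dots> = (\<integral>\<^sup>+ x. ennreal (indicator A x *\<^sub>R (\<integral>y. V y \<partial>K x)) \<partial>M)"
    proof (rule nn_integral_cong)
      fix x assume x: "x \<in> space M"
      have "(\<integral>\<^sup>+ y. ennreal (V y) \<partial>K x) = ennreal (\<integral>y. V y \<partial>K x)"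
        using V Kx[OF x] by (intro nn_integral_eq_integral intK x AE_I2) auto
      then show "indicator A x * (\<integral>\<^sup>+ y. ennreal (V y) \<partial>K x) = ennreal (indicator A x *\<^sub>R (\<integral>y. V y \<partial>K x))"
        by (simp split: split_indicator)
    qed
    also have "enn2real \<dots> = (\<integral>x\<in>A. (\<integral>y. V y \<partial>K x) \<partial>M)"
      unfolding set_lebesgue_integral_def
      using K_bd by (intro integral_eq_nn_integral[symmetric] AE_I2) auto
    finally show "(\<integral>x\<in>A. V (s' x) \<partial>M) = (\<integral>x\<in>A. (\<integral>y. V y \<partial>K x) \<partial>M)" .
  qed
qed

section \<open>The sigma-algebra of the past and the current state-action pair\<close>

lemma space_cond_sigma [simp]: "space (cond_sigma M G X SA) = space M"
  by (simp add: cond_sigma_def space_measure_of_conv)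

lemma sets_cond_sigma:
  assumes "subalgebra M G"
  shows "sets (cond_sigma M G X SA) =
    sigma_sets (space M) (sets G \<union> {X -` B \<inter> space M | B. B \<in> sets SA})"
proof -
  have "sets G \<subseteq> Pow (space M)"
    using assms sets.space_closed[of G] by (auto simp: subalgebra_def)
  then show ?thesis
    unfolding cond_sigma_def by (intro sets_measure_of) auto
qed

lemma subalgebra_cond_sigma:
  assumes "subalgebra M G" "X \<in> M \<rightarrow>\<^sub>M SA"
  shows "subalgebra M (cond_sigma M G X SA)"
  unfolding subalgebra_def sets_cond_sigma[OF assms(1)]
  using assms by (auto simp: subalgebra_def intro!: sets.sigma_sets_subset measurable_sets)

lemma measurable_cond_sigma_past:
  assumes "subalgebra M G" "f \<in> G \<rightarrow>\<^sub>M B"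
  shows "f \<in> cond_sigma M G X SA \<rightarrow>\<^sub>M B"
proof (rule measurable_from_subalg[OF _ assms(2)])
  show "subalgebra (cond_sigma M G X SA) G"
    using assms(1) unfolding subalgebra_def[of _ G] sets_cond_sigma[OF assms(1)]
    by (auto simp: subalgebra_def)
qed

lemma measurable_cond_sigma_present:
  assumes "subalgebra M G" "X \<in> M \<rightarrow>\<^sub>M SA"
  shows "X \<in> cond_sigma M G X SA \<rightarrow>\<^sub>M SA"
proof (rule measurableI)
  show "X x \<in> space SA" if "x \<in> space (cond_sigma M G X SA)" for x
    using that measurable_space[OF assms(2)] by simp
  show "X -` B \<inter> space (cond_sigma M G X SA) \<in> sets (cond_sigma M G X SA)" if "B \<in> sets SA" for B
    using that unfolding sets_cond_sigma[OF assms(1)] by auto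
qed

text \<open>No measurability is asked for: the integral of a non-integrable function is 0 by
  convention, which \<open>0 \<le> c\<close> covers. The bounds thus apply to \<open>Qval\<close>
  directly.\<close>

lemma prob_integral_bounds:
  fixes f :: "'a \<Rightarrow> real"
  assumes "prob_space \<mu>" "\<And>x. x \<in> space \<mu> \<Longrightarrow> 0 \<le> f x \<and> f x \<le> c" "0 \<le> c"
  shows "0 \<le> (\<integral>x. f x \<partial>\<mu>)" "(\<integral>x. f x \<partial>\<mu>) \<le> c"
proof -
  interpret prob_space \<mu> by fact
  show "0 \<le> (\<integral>x. f x \<partial>\<mu>)"
    using assms by (intro Bochner_Integration.integral_nonneg_AE AE_I2) auto
  show "(\<integral>x. f x \<partial>\<mu>) \<le> c"
    using assms by (cases "integrable \<mu> f") (auto intro!: integral_le_const AE_I2 simp: not_integrable_integral_eq)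
qed

text \<open>The integrand varies with \<open>x\<close> as well. Pushing \<open>K x\<close> forward
  along \<open>y \<mapsto> (x, y)\<close> gives a kernel on the product, against which the integrand
  is fixed.\<close>

lemma measurable_integral_kernel2:
  fixes f :: "'s \<Rightarrow> 'a \<Rightarrow> 'b::{banach, second_countable_topology}"
  assumes f[measurable]: "(\<lambda>(x, y). f x y) \<in> borel_measurable (S \<Otimes>\<^sub>M A)"
    and K: "K \<in> S \<rightarrow>\<^sub>M prob_algebra A"
  shows "(\<lambda>x. \<integral>y. f x y \<partial>K x) \<in> borel_measurable S"
proof -
  have L[measurable]: "K \<in> S \<rightarrow>\<^sub>M subprob_algebra A"
    using K by (rule measurable_prob_algebraD)
  note measurable_distr2[measurable]
  have "(\<lambda>x. integral\<^sup>L (distr (K x) (S \<Otimes>\<^sub>M A) (\<lambda>y. (x, y))) (\<lambda>(x, y). f x y)) \<in> borel_measurable S"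
    by measurable
  then show ?thesis
    by (rule measurable_cong[THEN iffD1, rotated])
       (simp add: integral_distr cong: measurable_cong_sets)
qed

text \<open>\<open>\<eta> k\<close> is the defect of \<open>w\<close> in the fitted recursion. Each
  unrolling moves one factor \<open>M\<close> onto \<open>\<nu>\<close> as its transpose, so after
  \<open>h\<close> steps the defect at \<open>n - 1 - h\<close> meets
  \<open>nuhat M \<nu> h\<close>.\<close>

lemma inner_west_diff:
  fixes M :: "real^'d^'d"
  assumes "\<And>k. \<eta> k = R + M *v w k - w (Suc k)" "w 0 = 0"
  shows "\<nu> \<bullet> (west R M n - w n) = (\<Sum>h<n. nuhat M \<nu> h \<bullet> \<eta> (n - 1 - h))"
proof (induction n arbitrary: \<nu>)
  case 0
  then show ?case using assms by simp
next
  case (Suc n)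
  have "west R M (Suc n) - w (Suc n) = M *v (west R M n - w n) + \<eta> n"
    by (simp add: assms(1) matrix_vector_mult_diff_distrib)
  then have "\<nu> \<bullet> (west R M (Suc n) - w (Suc n)) = (transpose M *v \<nu>) \<bullet> (west R M n - w n) + \<nu> \<bullet> \<eta> n"
    by (simp add: inner_add_right dot_lmul_matrix)
  also have "\<dots> = (\<Sum>h<n. nuhat M (transpose M *v \<nu>) h \<bullet> \<eta> (n - 1 - h)) + \<nu> \<bullet> \<eta> n"
    by (simp only: Suc.IH)
  also have "\<dots> = (\<Sum>h<Suc n. nuhat M \<nu> h \<bullet> \<eta> (Suc n - 1 - h))"
    unfolding sum.lessThan_Suc_shift
    by (simp add: nuhat_def funpow_swap1 del: funpow.simps(2) add: funpow_Suc_right del: transpose_matrix_vector)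
  finally show ?case .
qed

text \<open>Absorbs the sub-Gaussian radius, with confidence split over \<open>H + 1\<close> events,
  into the stated one. It rests on \<open>H + 1 \<le> 3 * N\<^sup>2 * H\<close> and on
  \<open>L \<ge> 1\<close>.\<close>

lemma confidence_radius_le:
  fixes H N :: nat
  assumes "H \<ge> 1" "N \<ge> 1" "0 < \<delta>" "\<delta> < 1" "0 \<le> D"
    and "Z \<le> D + ln (1 / (\<delta> / real (H + 1))) / 2"
  defines "L \<equiv> ln (3 * real N ^ 2 * real H / \<delta>)"
  shows "sqrt Z \<le> 2 * sqrt (2 * D * L) + 4 / 3 * L"
proof -
  have N2: "1 \<le> real N ^ 2"
    using assms(2) by simp
  have NH: "real H \<le> real N ^ 2 * real H"
    using N2 by (simp add: mult_le_cancel_right1)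
  have "real (H + 1) \<le> 3 * real N ^ 2 * real H"
    using NH assms(1) unfolding mult.assoc of_nat_add by linarith
  then have "(real (H + 1)) / \<delta> \<le> 3 * real N ^ 2 * real H / \<delta>"
    using assms by (intro divide_right_mono) auto
  then have 1: "ln (1 / (\<delta> / real (H + 1))) \<le> L"
    unfolding L_def using assms by (subst ln_le_cancel_iff) auto
  \<comment> \<open>The argument of the logarithm is at least 3, hence at least
    \<open>exp 1\<close>.\<close>
  have "3 \<le> 3 * real N ^ 2 * real H"
    using NH assms(1) unfolding mult.assoc by linarith
  also have "\<dots> \<le> 3 * real N ^ 2 * real H / \<delta>"
    using assms by (simp add: field_simps mult_left_le)
  finally have "exp 1 \<le> 3 * real N ^ 2 * real H / \<delta>"
    using exp_le by linarith
  then have L1: "1 \<le> L"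
    unfolding L_def using assms by (subst ln_ge_iff) auto
  have "Z \<le> D + L / 2"
    using 1 assms(6) by linarith
  then have "sqrt Z \<le> sqrt (D + L / 2)"
    by simp
  also have "\<dots> \<le> sqrt D + sqrt (L / 2)"
    using assms(5) L1 by (intro sqrt_add_le_add_sqrt) auto
  \<comment> \<open>Slack from \<open>L \<ge> 1\<close>: here \<open>D \<le> 8 * D * L\<close>, and
    below \<open>L / 2 \<le> (4 / 3 * L)\<^sup>2\<close>.\<close>
  also have "sqrt D \<le> sqrt (4 * (2 * D * L))"
    using mult_left_mono[OF L1 assms(5)] assms(5) by (intro real_sqrt_le_mono) linarith
  also have "\<dots> = 2 * sqrt (2 * D * L)"
    unfolding real_sqrt_mult[of 4] by simp
  also have "sqrt (L / 2) \<le> 4 / 3 * L"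
  proof (rule real_le_lsqrt)
    have "L \<le> L * L" using L1 by (simp add: mult_le_cancel_left1)
    then show "L / 2 \<le> (4 / 3 * L)\<^sup>2"
      using L1 by (simp add: power2_eq_square)
  qed (use L1 in auto)
  finally show ?thesis by simp
qed

theorem theorem4:
  fixes M :: "'w measure" and F :: "nat \<Rightarrow> 'w measure"
    and S :: "'s measure" and A :: "'a measure"
    and p :: "'s \<times> 'a \<Rightarrow> 's measure" and \<pi> :: "'s \<Rightarrow> 'a measure" and \<xi>0 :: "'s measure"
    and r :: "'s \<Rightarrow> 'a \<Rightarrow> real" and \<phi> :: "'s \<Rightarrow> 'a \<Rightarrow> real^'d"
    and H N :: nat and lam \<delta> :: real
    and s s' :: "nat \<Rightarrow> 'w \<Rightarrow> 's" and a :: "nat \<Rightarrow> 'w \<Rightarrow> 'a" and rw :: "nat \<Rightarrow> 'w \<Rightarrow> real"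
  assumes M: "prob_space M"
    and filt: "filtration (space M) F" "\<And>t. sets (F t) \<subseteq> sets M"
    and kernel_p: "p \<in> S \<Otimes>\<^sub>M A \<rightarrow>\<^sub>M prob_algebra S"
    and kernel_pi: "\<pi> \<in> S \<rightarrow>\<^sub>M prob_algebra A"
    and init: "prob_space \<xi>0" "sets \<xi>0 = sets S"
    and phi_meas: "(\<lambda>(x, y). \<phi> x y) \<in> borel_measurable (S \<Otimes>\<^sub>M A)"
    and r_range: "\<forall>x\<in>space S. \<forall>y\<in>space A. 0 \<le> r x y \<and> r x y \<le> 1"
    and A1_r: "\<exists>wr. \<forall>x\<in>space S. \<forall>y\<in>space A. r x y = \<phi> x y \<bullet> wr"
    and A1_P: "\<forall>w. \<exists>w'. \<forall>x\<in>space S. \<forall>y\<in>space A.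
                  Ppi p \<pi> (\<lambda>x' y'. \<phi> x' y' \<bullet> w) x y = \<phi> x y \<bullet> w'"
    and lam_pos: "lam > 0"
    and phi_bd: "\<forall>x\<in>space S. \<forall>y\<in>space A. norm (\<phi> x y) \<le> 1"
    and adapted: "\<forall>t\<in>{1..N}. s t \<in> F t \<rightarrow>\<^sub>M S \<and> a t \<in> F t \<rightarrow>\<^sub>M A \<and>
                     s' t \<in> F t \<rightarrow>\<^sub>M S \<and> rw t \<in> borel_measurable (F t)"
    and cond_trans: "\<forall>t\<in>{1..N}. \<forall>B\<in>sets S. AE x in M.
        real_cond_exp M (cond_sigma M (F (t - 1)) (\<lambda>y. (s t y, a t y)) (S \<Otimes>\<^sub>M A))
          (indicator {y \<in> space M. s' t y \<in> B}) x = measure (p (s t x, a t x)) B"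
    and cond_rew: "\<forall>t\<in>{1..N}. AE x in M.
        real_cond_exp M (cond_sigma M (F (t - 1)) (\<lambda>y. (s t y, a t y)) (S \<Otimes>\<^sub>M A))
          (rw t) x = r (s t x) (a t x)"
    and rw_range: "\<forall>t\<in>{1..N}. \<forall>x\<in>space M. 0 \<le> rw t x \<and> rw t x \<le> 1"
    and H_pos: "H \<ge> 1" and N_pos: "N \<ge> 1"
    and delta: "0 < \<delta>" "\<delta> < 1"
  shows "\<exists>E\<in>sets M. measure M E \<ge> 1 - \<delta> \<and>
    (\<forall>x\<in>E.
      (let d = real CARD('d);
           Sig = SigmaHat lam \<phi> N (\<lambda>t. s t x) (\<lambda>t. a t x);
           Rh = RHat lam \<phi> N (\<lambda>t. s t x) (\<lambda>t. a t x) (\<lambda>t. rw t x);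
           Mh = MHat lam \<phi> \<pi> N (\<lambda>t. s t x) (\<lambda>t. a t x) (\<lambda>t. s' t x);
           \<nu> = nu0 \<xi>0 \<pi> \<phi>;
           L = ln (3 * real N ^ 2 * real H / \<delta>)
       in ereal \<bar>vpi \<xi>0 p \<pi> r H - vhat H \<nu> Rh Mh\<bar>
          \<le> (\<Sum>h=0..H. ereal (real (H - h + 1) *
                 sqrt (nuhat Mh \<nu> h \<bullet> (matrix_inv Sig *v nuhat Mh \<nu> h))) *
               (ereal (sqrt (2 * lam)) * omega S A \<phi> +
                ereal (2 * sqrt (2 * d * ln (1 + real N / (lam * d)) * L) + 4 / 3 * L)))))"
proof -

  \<comment> \<open>Filtration and probability kernels\<close>
  interpret prob_space M by fact
  interpret filtration "space M" F by fact
  note \<phi>_meas[measurable] = phi_meas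
  have subF: "subalgebra M (F t)" for t
    using filt space_F by (auto simp: subalgebra_def)
  define G where "G t = cond_sigma M (F (t - 1)) (\<lambda>y. (s t y, a t y)) (S \<Otimes>\<^sub>M A)" for t
  have Kp: "prob_space (p (x, y))" "space (p (x, y)) = space S" "sets (p (x, y)) = sets S"
    if "x \<in> space S" "y \<in> space A" for x y
    using measurable_space[OF kernel_p, of "(x, y)"] that
    by (auto simp: space_pair_measure space_prob_algebra dest: sets_eq_imp_space_eq)
  have Kpi: "prob_space (\<pi> x)" "space (\<pi> x) = space A" "sets (\<pi> x) = sets A"
    if "x \<in> space S" for x
    using measurable_space[OF kernel_pi that]
    by (auto simp: space_prob_algebra dest: sets_eq_imp_space_eq)
  have sp_\<xi>0: "space \<xi>0 = space S"
    using init(2) by (rule sets_eq_imp_space_eq)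

  \<comment> \<open>Linearity and range of the true Q-functions\<close>
  have Ppi_cong: "Ppi p \<pi> f x y = Ppi p \<pi> g x y"
    if "\<And>x y. x \<in> space S \<Longrightarrow> y \<in> space A \<Longrightarrow> f x y = g x y" "x \<in> space S" "y \<in> space A" for f g x y
    unfolding Ppi_def using that Kp[OF that(2,3)] Kpi
    by (intro Bochner_Integration.integral_cong refl) auto
  \<comment> \<open>\<open>k\<close> counts the steps still to come, so the parameter belongs to
    \<open>h = H - k\<close>. Linearity holds on the state and action spaces only, hence the
    congruence rule for \<open>Ppi\<close>.\<close>
  have "\<exists>w. \<forall>x\<in>space S. \<forall>y\<in>space A. Qval p \<pi> r k x y = \<phi> x y \<bullet> w" for k
  proof (induction k)
    case 0
    then show ?case using A1_r by simp
  next
    case (Suc k)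
    then obtain w where w: "\<And>x y. x \<in> space S \<Longrightarrow> y \<in> space A \<Longrightarrow> Qval p \<pi> r k x y = \<phi> x y \<bullet> w"
      by auto
    obtain w' where w': "\<forall>x\<in>space S. \<forall>y\<in>space A. Ppi p \<pi> (\<lambda>x' y'. \<phi> x' y' \<bullet> w) x y = \<phi> x y \<bullet> w'"
      using A1_P by blast
    obtain wr where wr: "\<forall>x\<in>space S. \<forall>y\<in>space A. r x y = \<phi> x y \<bullet> wr"
      using A1_r by blast
    have "Qval p \<pi> r (Suc k) x y = \<phi> x y \<bullet> (wr + w')" if "x \<in> space S" "y \<in> space A" for x y
      using wr w' that Ppi_cong[of "Qval p \<pi> r k" "\<lambda>x' y'. \<phi> x' y' \<bullet> w", OF w that]
      by (simp add: inner_add_right)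
    then show ?case by blast
  qed
  then obtain wq where wq: "\<And>k x y. x \<in> space S \<Longrightarrow> y \<in> space A \<Longrightarrow> Qval p \<pi> r k x y = \<phi> x y \<bullet> wq k"
    by metis
  have Q_bd: "0 \<le> Qval p \<pi> r k x y \<and> Qval p \<pi> r k x y \<le> real (k + 1)"
    if "x \<in> space S" "y \<in> space A" for k x y
    using that
  proof (induction k arbitrary: x y)
    case 0
    then show ?case using r_range by simp
  next
    case (Suc k)
    have inner: "0 \<le> (\<integral>a'. Qval p \<pi> r k s' a' \<partial>\<pi> s') \<and> (\<integral>a'. Qval p \<pi> r k s' a' \<partial>\<pi> s') \<le> real (k + 1)"
      if "s' \<in> space S" for s'
      using prob_integral_bounds[OF Kpi(1)[OF that], of "Qval p \<pi> r k s'" "real (k + 1)"] Suc.IH that Kpi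
      by auto
    have "0 \<le> Ppi p \<pi> (Qval p \<pi> r k) x y" "Ppi p \<pi> (Qval p \<pi> r k) x y \<le> real (k + 1)"
      unfolding Ppi_def using Kp(2)[OF Suc.prems] inner
        prob_integral_bounds[OF Kp(1)[OF Suc.prems], of "\<lambda>s'. \<integral>a'. Qval p \<pi> r k s' a' \<partial>\<pi> s'" "real (k + 1)"]
      by simp_all
    moreover have "0 \<le> r x y" "r x y \<le> 1"
      using r_range Suc.prems by auto
    ultimately show ?case by simp
  qed

  \<comment> \<open>Policy-averaged features and the true value as a linear form\<close>
  have \<phi>_sec[measurable]: "\<phi> x \<in> borel_measurable A" if "x \<in> space S" for x
    using measurable_compose_Pair1[OF that \<phi>_meas] by simp
  have \<phi>_int: "integrable (\<pi> x) (\<phi> x)" if "x \<in> space S" for x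
  proof -
    interpret P: prob_space "\<pi> x" using Kpi that by auto
    show ?thesis
      using phi_bd that Kpi[OF that] \<phi>_sec[OF that]
      by (intro P.integrable_const_bound[of _ 1] AE_I2) (auto cong: measurable_cong_sets)
  qed
  have phi_pi_inner: "phi_pi \<pi> \<phi> x \<bullet> wq k = (\<integral>y. Qval p \<pi> r k x y \<partial>\<pi> x)" if "x \<in> space S" for x k
  proof -
    have "phi_pi \<pi> \<phi> x \<bullet> wq k = (\<integral>y. \<phi> x y \<bullet> wq k \<partial>\<pi> x)"
      unfolding phi_pi_def using \<phi>_int[OF that] by (intro integral_inner_left[symmetric]) auto
    also have "\<dots> = (\<integral>y. Qval p \<pi> r k x y \<partial>\<pi> x)"
      using wq that Kpi by (intro Bochner_Integration.integral_cong) auto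
    finally show ?thesis .
  qed
  have phi_pi_meas[measurable]: "phi_pi \<pi> \<phi> \<in> borel_measurable S"
    unfolding phi_pi_def[abs_def] by (rule measurable_integral_kernel2[OF \<phi>_meas kernel_pi])
  have phi_pi_norm: "norm (phi_pi \<pi> \<phi> x) \<le> 1" if "x \<in> space S" for x
  proof -
    have "norm (phi_pi \<pi> \<phi> x) \<le> (\<integral>y. norm (\<phi> x y) \<partial>\<pi> x)"
      unfolding phi_pi_def by (rule integral_norm_bound)
    also have "\<dots> \<le> 1"
      using Kpi[OF that] phi_bd that by (intro prob_integral_bounds) auto
    finally show ?thesis .
  qed
  have vpi_eq: "vpi \<xi>0 p \<pi> r H = nu0 \<xi>0 \<pi> \<phi> \<bullet> wq H"
  proof -
    interpret X: prob_space \<xi>0 by fact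
    have "integrable \<xi>0 (phi_pi \<pi> \<phi>)"
      using phi_pi_norm init sp_\<xi>0 phi_pi_meas
      by (intro X.integrable_const_bound[of _ 1] AE_I2) (auto cong: measurable_cong_sets)
    then have "nu0 \<xi>0 \<pi> \<phi> \<bullet> wq H = (\<integral>x. phi_pi \<pi> \<phi> x \<bullet> wq H \<partial>\<xi>0)"
      unfolding nu0_def phi_pi_def[symmetric] by (intro integral_inner_left[symmetric]) auto
    also have "\<dots> = vpi \<xi>0 p \<pi> r H"
      unfolding vpi_def using sp_\<xi>0 phi_pi_inner by (intro Bochner_Integration.integral_cong) auto
    finally show ?thesis by simp
  qed

  \<comment> \<open>Value functions and the Bellman equation\<close>
  define wt where "wt k = (case k of 0 \<Rightarrow> 0 | Suc j \<Rightarrow> wq j)" for k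
  \<comment> \<open>The true value of a state with \<open>k\<close> rewards ahead. The shift in
    \<open>wt\<close> puts the terminal parameter 0 at index 0, in line with
    \<open>west\<close>.\<close>
  define V where "V k x = phi_pi \<pi> \<phi> x \<bullet> wt k" for k x
  have V_meas[measurable]: "V k \<in> borel_measurable S" for k
    unfolding V_def by measurable
  have V_bd: "0 \<le> V k x \<and> V k x \<le> real k" if "x \<in> space S" for k x
  proof (cases k)
    case (Suc j)
    have "V k x = (\<integral>y. Qval p \<pi> r j x y \<partial>\<pi> x)"
      using phi_pi_inner[OF that] by (simp add: V_def wt_def Suc)
    then show ?thesis
      using prob_integral_bounds[OF Kpi(1)[OF that], of "Qval p \<pi> r j x" "real (j + 1)"] Q_bd that Kpi Suc
      by auto
  qed (simp add: V_def wt_def)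
  have Bellman: "\<phi> x y \<bullet> wq k = r x y + (\<integral>x'. V k x' \<partial>p (x, y))" if "x \<in> space S" "y \<in> space A" for x y k
  proof (cases k)
    case 0
    then show ?thesis using wq[OF that, of 0] by (simp add: V_def wt_def)
  next
    case (Suc j)
    have "(\<integral>x'. V k x' \<partial>p (x, y)) = Ppi p \<pi> (Qval p \<pi> r j) x y"
      unfolding Ppi_def using Kp[OF that] phi_pi_inner
      by (intro Bochner_Integration.integral_cong) (auto simp: V_def wt_def Suc)
    then show ?thesis using wq[OF that, of k] by (simp add: Suc)
  qed

  \<comment> \<open>Regression targets, scaled by \<open>k + 1\<close> into the unit interval, and
    their conditional means\<close>
  define X where "X k t x = (rw t x + V k (s' t x)) / real (k + 1)" for k t x
  define q where "q k t x = (\<phi> (s t x) (a t x) \<bullet> wq k) / real (k + 1)" for k t x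
  define ph where "ph t x = \<phi> (s t x) (a t x)" for t x
  have F_meas: "s t \<in> F t \<rightarrow>\<^sub>M S" "a t \<in> F t \<rightarrow>\<^sub>M A" "s' t \<in> F t \<rightarrow>\<^sub>M S" "rw t \<in> borel_measurable (F t)"
    if "t \<in> {1..N}" for t
    using adapted that by auto
  have M_meas: "s t \<in> M \<rightarrow>\<^sub>M S" "a t \<in> M \<rightarrow>\<^sub>M A" "s' t \<in> M \<rightarrow>\<^sub>M S" "rw t \<in> borel_measurable M"
    if "t \<in> {1..N}" for t
    using F_meas[OF that] measurable_from_subalg[OF subF] by auto
  have sp: "s t x \<in> space S" "a t x \<in> space A" "s' t x \<in> space S" if "t \<in> {1..N}" "x \<in> space M" for t x
    using M_meas[OF that(1)] that(2) by (auto dest: measurable_space)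
  have sa_M: "(\<lambda>y. (s t y, a t y)) \<in> M \<rightarrow>\<^sub>M S \<Otimes>\<^sub>M A" if "t \<in> {1..N}" for t
    using M_meas[OF that] by (intro measurable_Pair) auto
  have subG: "subalgebra M (G t)" if "t \<in> {1..N}" for t
    unfolding G_def by (rule subalgebra_cond_sigma[OF subF sa_M[OF that]])
  have sa_G: "(\<lambda>y. (s t y, a t y)) \<in> G t \<rightarrow>\<^sub>M S \<Otimes>\<^sub>M A" if "t \<in> {1..N}" for t
    unfolding G_def by (rule measurable_cond_sigma_present[OF subF sa_M[OF that]])
  \<comment> \<open>For \<open>i < t\<close> the step-\<open>i\<close> data are known to
    \<open>F (t - 1)\<close>, one of the generators of \<open>G t\<close>.\<close>
  have past: "f \<in> G t \<rightarrow>\<^sub>M B" if "f \<in> F i \<rightarrow>\<^sub>M B" "i \<in> {1..<t}" for f i t and B :: "'z measure"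
  proof -
    have "subalgebra (F (t - 1)) (F i)"
      using sets_F_mono[of i "t - 1"] that(2) space_F by (force simp: subalgebra_def)
    then have "f \<in> F (t - 1) \<rightarrow>\<^sub>M B"
      using that(1) by (rule measurable_from_subalg)
    then show ?thesis
      unfolding G_def by (rule measurable_cond_sigma_past[OF subF])
  qed
  have sa_G': "(\<lambda>y. (s i y, a i y)) \<in> G t \<rightarrow>\<^sub>M S \<Otimes>\<^sub>M A" if "t \<in> {1..N}" "i \<in> {1..t}" for t i
  proof (cases "i = t")
    case True
    then show ?thesis using sa_G that by simp
  next
    case False
    have "(\<lambda>y. (s i y, a i y)) \<in> F i \<rightarrow>\<^sub>M S \<Otimes>\<^sub>M A"
      using F_meas[of i] that by (intro measurable_Pair) auto
    then show ?thesis using that False by (intro past) auto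
  qed
  have ph_G: "ph i \<in> borel_measurable (G t)" if "t \<in> {1..N}" "i \<in> {1..t}" for t i
    using measurable_compose[OF sa_G'[OF that] \<phi>_meas] by (simp add: ph_def[abs_def])
  have q_G: "q k i \<in> borel_measurable (G t)" if "t \<in> {1..N}" "i \<in> {1..t}" for k t i
    using ph_G[OF that] unfolding q_def[abs_def] ph_def[abs_def] by measurable
  have X_F: "X k i \<in> borel_measurable (F i)" if "i \<in> {1..N}" for k i
    using F_meas[OF that] unfolding X_def[abs_def] by measurable
  have X01: "0 \<le> X k t x \<and> X k t x \<le> 1" if "t \<in> {1..N}" "x \<in> space M" for k t x
    using rw_range that V_bd[of "s' t x" k] sp[OF that] by (auto simp: X_def add_mono)
  have q01: "0 \<le> q k t x \<and> q k t x \<le> 1" if "t \<in> {1..N}" "x \<in> space M" for k t x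
    using Q_bd[of "s t x" "a t x" k] wq[of "s t x" "a t x" k] sp[OF that] by (simp add: q_def)
  \<comment> \<open>The reward has conditional mean \<open>r\<close> and the next value that of the
    kernel integral; the Bellman equation identifies their sum with
    \<open>\<phi> \<bullet> wq k\<close>.\<close>
  have ce: "AE x in M. real_cond_exp M (G t) (X k t) x = q k t x" if t: "t \<in> {1..N}" for k t
  proof -
    interpret g: finite_measure_subalgebra M "G t"
      by unfold_locales (rule subG[OF t])
    have rw_int: "integrable M (rw t)"
      using rw_range t M_meas[OF t] by (intro integrable_const_bound[of _ 1] AE_I2) auto
    have V_M: "(\<lambda>x. V k (s' t x)) \<in> borel_measurable M"
      using M_meas[OF t] by measurable
    have V_int: "integrable M (\<lambda>x. V k (s' t x))"
      using V_bd sp[OF t] V_M by (intro integrable_const_bound[of _ "real k"] AE_I2) auto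
    have 1: "AE x in M. real_cond_exp M (G t) (\<lambda>x. V k (s' t x)) x = (\<integral>y. V k y \<partial>p (s t x, a t x))"
    proof (rule cond_exp_kernel[OF M subG[OF t] _ M_meas(3)[OF t]])
      show "(\<lambda>x. p (s t x, a t x)) \<in> G t \<rightarrow>\<^sub>M prob_algebra S"
        by (rule measurable_compose[OF sa_G[OF t] kernel_p])
      show "AE x in M. real_cond_exp M (G t) (indicator {y \<in> space M. s' t y \<in> B}) x = measure (p (s t x, a t x)) B"
        if "B \<in> sets S" for B
        unfolding G_def using cond_trans t that by blast
    qed (use V_bd V_meas in auto)
    have 2: "AE x in M. real_cond_exp M (G t) (rw t) x = r (s t x) (a t x)"
      unfolding G_def using cond_rew t by blast
    have 3: "AE x in M. real_cond_exp M (G t) (\<lambda>x. rw t x + V k (s' t x)) x =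
        real_cond_exp M (G t) (rw t) x + real_cond_exp M (G t) (\<lambda>x. V k (s' t x)) x"
      by (rule g.real_cond_exp_add[OF rw_int V_int])
    have 4: "AE x in M. real_cond_exp M (G t) (X k t) x =
        real_cond_exp M (G t) (\<lambda>x. rw t x + V k (s' t x)) x / real (k + 1)"
      unfolding X_def[abs_def] using rw_int V_int by (intro g.real_cond_exp_cdiv) auto
    show ?thesis
      using 1 2 3 4 AE_space
    proof eventually_elim
      case (elim x)
      then show ?case
        using Bellman[of "s t x" "a t x" k] sp[OF t] by (simp add: q_def)
    qed
  qed

  \<comment> \<open>Union bound over the horizon\<close>
  define d where "d = real CARD('d)"
  \<comment> \<open>One concentration event for each \<open>k\<close> from 0 to \<open>H\<close>, so
    \<open>H + 1\<close> equal shares.\<close>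
  define \<delta>' where "\<delta>' = \<delta> / real (H + 1)"
  define D where "D = d * ln (1 + real N / (lam * d))"
  have \<delta>': "\<delta>' > 0" using delta by (simp add: \<delta>'_def)
  have "\<exists>E\<in>sets M. measure M E \<ge> 1 - \<delta>' \<and>
    (\<forall>x\<in>E. noise_sqnorm lam (\<lambda>t. ph t x) (\<lambda>t. X k t x - q k t x) N \<le> D + ln (1 / \<delta>') / 2)" for k
    unfolding D_def d_def
  proof (rule self_normalized_bound[where G = G, OF M subG ph_G _ q_G _ X01 q01 ce _ lam_pos \<delta>'])
    show "X k i \<in> borel_measurable (G t)" if "t \<in> {1..N}" "i \<in> {1..<t}" for t i
      using X_F[of i k] that by (intro past) auto
    show "X k t \<in> borel_measurable M" if "t \<in> {1..N}" for t
      using measurable_from_subalg[OF subF X_F[OF that]] .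
    show "norm (ph t x) \<le> 1" if "t \<in> {1..N}" "x \<in> space M" for t x
      using phi_bd sp[OF that] by (simp add: ph_def)
  qed
  then obtain E where E: "\<And>k. E k \<in> sets M" "\<And>k. prob (E k) \<ge> 1 - \<delta>'"
    and EZ: "\<And>k x. x \<in> E k \<Longrightarrow> noise_sqnorm lam (\<lambda>t. ph t x) (\<lambda>t. X k t x - q k t x) N \<le> D + ln (1 / \<delta>') / 2"
    by metis
  define E0 where "E0 = space M - (\<Union>k\<in>{0..H}. space M - E k)"
  have E0: "E0 \<in> sets M" "\<And>x k. x \<in> E0 \<Longrightarrow> k \<le> H \<Longrightarrow> x \<in> E k" "E0 \<subseteq> space M"
    using E unfolding E0_def by auto
  have "prob (\<Union>k\<in>{0..H}. space M - E k) \<le> (\<Sum>k\<in>{0..H}. prob (space M - E k))"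
    using E by (intro finite_measure_subadditive_finite) auto
  also have "\<dots> \<le> (\<Sum>k\<in>{0..H}. \<delta>')"
    using E by (intro sum_mono) (simp add: prob_compl algebra_simps)
  also have "\<dots> = \<delta>"
    by (simp add: \<delta>'_def)
  finally have E0_prob: "prob E0 \<ge> 1 - \<delta>"
    unfolding E0_def using E by (subst prob_compl) auto

  show ?thesis

  \<comment> \<open>Error bound on the good event\<close>
  proof (rule bexI[OF _ E0(1)], intro conjI ballI)
    fix x assume x: "x \<in> E0"
    then have xM: "x \<in> space M" using E0 by auto
    define \<nu> where "\<nu> = nu0 \<xi>0 \<pi> \<phi>"
    define Sig where "Sig = SigmaHat lam \<phi> N (\<lambda>t. s t x) (\<lambda>t. a t x)"
    define Rh where "Rh = RHat lam \<phi> N (\<lambda>t. s t x) (\<lambda>t. a t x) (\<lambda>t. rw t x)"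
    define Mh where "Mh = MHat lam \<phi> \<pi> N (\<lambda>t. s t x) (\<lambda>t. a t x) (\<lambda>t. s' t x)"
    define L where "L = ln (3 * real N ^ 2 * real H / \<delta>)"
    define W where "W = gram_inv lam (\<lambda>t. ph t x) N"
    have Sig: "Sig = gram lam (\<lambda>t. ph t x) N"
      by (simp add: Sig_def SigmaHat_def gram_def ph_def)
    have SigW: "Sig ** W = mat 1"
      unfolding matrix_eq Sig W_def
      by (simp add: matrix_vector_mul_assoc[symmetric] gram_gram_inv_vec[OF lam_pos])
    then have WSig: "W ** Sig = mat 1"
      by (simp add: matrix_left_right_inverse)
    have inv: "matrix_inv Sig = W"
      by (rule matrix_inv_eqI[OF SigW])
    define \<eta> where "\<eta> k = Rh + Mh *v wt k - wt (Suc k)" for k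
    define T where "T k = noise_sum (\<lambda>t. ph t x) (\<lambda>t. X k t x - q k t x) N" for k
    \<comment> \<open>Scaled so that its linear form is \<open>Qval / (k + 1)\<close> and lies in
      the unit interval; this makes \<open>w' k\<close> a competitor in
      \<open>omega\<close>.\<close>
    define w' where "w' k = (1 / real (k + 1)) *\<^sub>R wq k" for k
    \<comment> \<open>Writing \<open>wq k\<close> as \<open>W *v (Sig *v wq k)\<close> turns the
      defect into \<open>W\<close> applied to the accumulated Bellman residuals minus the
      regularisation bias \<open>lam *\<^sub>R wq k\<close>.\<close>
    have \<eta>_eq: "\<eta> k = real (k + 1) *\<^sub>R (W *v (T k - lam *\<^sub>R w' k))" for k
    proof -
      have fit: "Rh + Mh *v wt k = W *v ((\<Sum>t=1..N. rw t x *\<^sub>R ph t x) + (\<Sum>t=1..N. V k (s' t x) *\<^sub>R ph t x))"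
        by (simp add: Rh_def Mh_def RHat_def MHat_def Sig_def[symmetric] inv matrix_vector_mul_assoc[symmetric]
            sum_matrix_vector_mult outer_mult_vec matrix_vector_right_distrib ph_def V_def)
      have "wq k = W *v (Sig *v wq k)"
        by (simp add: matrix_vector_mul_assoc WSig)
      then have true: "wq k = W *v (lam *\<^sub>R wq k + (\<Sum>t=1..N. (ph t x \<bullet> wq k) *\<^sub>R ph t x))"
        by (simp add: Sig gram_mult_vec)
      have noise: "real (k + 1) *\<^sub>R T k = (\<Sum>t=1..N. rw t x *\<^sub>R ph t x) + (\<Sum>t=1..N. V k (s' t x) *\<^sub>R ph t x)
          - (\<Sum>t=1..N. (ph t x \<bullet> wq k) *\<^sub>R ph t x)"
      proof -
        have "real (k + 1) * (X k t x - q k t x) = rw t x + V k (s' t x) - ph t x \<bullet> wq k" for t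
          unfolding X_def q_def ph_def right_diff_distrib by (simp del: of_nat_add of_nat_Suc)
        then show ?thesis
          unfolding T_def noise_sum_def scaleR_sum_right scaleR_scaleR
          by (simp add: scaleR_left_distrib scaleR_left_diff_distrib sum.distrib sum_subtractf)
      qed
      have reg: "real (k + 1) *\<^sub>R (lam *\<^sub>R w' k) = lam *\<^sub>R wq k"
        by (simp add: w'_def)
      have "\<eta> k = W *v (real (k + 1) *\<^sub>R T k - real (k + 1) *\<^sub>R (lam *\<^sub>R w' k))"
        unfolding \<eta>_def wt_def[of "Suc k"] nat.case fit noise reg
        by (subst true) (simp add: matrix_vector_mult_diff_distrib[symmetric] algebra_simps)
      then show ?thesis
        by (simp only: scaleR_right_diff_distrib[symmetric] matrix_vector_mult_scaleR)
    qed
    define rad where "rad = 2 * sqrt (2 * d * ln (1 + real N / (lam * d)) * L) + 4 / 3 * L"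
    have D0: "0 \<le> D"
      using lam_pos by (simp add: D_def d_def)
    have step_bound: "ereal \<bar>nuhat Mh \<nu> h \<bullet> \<eta> (H - h)\<bar> \<le>
        ereal (real (H - h + 1) * sqrt (nuhat Mh \<nu> h \<bullet> (W *v nuhat Mh \<nu> h))) *
          (ereal (sqrt (2 * lam)) * omega S A \<phi> + ereal rad)" for h
    proof -
      define k where "k = H - h"
      define v where "v = nuhat Mh \<nu> h"
      define c where "c = real (k + 1) * sqrt (v \<bullet> (W *v v))"
      have nnW: "0 \<le> z \<bullet> (W *v z)" for z
        unfolding W_def by (rule gram_inv_nonneg[OF lam_pos])
      have c0: "0 \<le> c"
        unfolding c_def using nnW by simp
      have "sqrt (T k \<bullet> (W *v T k)) \<le> 2 * sqrt (2 * D * L) + 4 / 3 * L"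
        unfolding L_def
      proof (rule confidence_radius_le[OF H_pos N_pos delta D0])
        show "T k \<bullet> (W *v T k) \<le> D + ln (1 / (\<delta> / real (H + 1))) / 2"
          using EZ[OF E0(2)[OF x, of k]] unfolding T_def W_def noise_sqnorm_def \<delta>'_def by (simp add: k_def)
      qed
      then have 1: "sqrt (T k \<bullet> (W *v T k)) \<le> rad"
        by (simp add: rad_def D_def mult.assoc)
      have "(lam *\<^sub>R w' k) \<bullet> (W *v (lam *\<^sub>R w' k)) = lam * (lam * (w' k \<bullet> (W *v w' k)))"
        by (simp add: matrix_vector_mult_scaleR)
      also have "\<dots> \<le> lam * (norm (w' k))\<^sup>2"
        using gram_inv_quadratic_le[OF lam_pos] lam_pos unfolding W_def by (intro mult_left_mono) auto
      \<comment> \<open>The bias costs \<open>lam\<close>; the factor 2 only matches the stated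
        \<open>sqrt (2 * lam)\<close>.\<close>
      also have "\<dots> \<le> 2 * lam * (norm (w' k))\<^sup>2"
        using lam_pos by (simp add: mult_right_mono)
      finally have "sqrt ((lam *\<^sub>R w' k) \<bullet> (W *v (lam *\<^sub>R w' k))) \<le> sqrt (2 * lam * (norm (w' k))\<^sup>2)"
        by (rule real_sqrt_le_mono)
      then have 2: "sqrt ((lam *\<^sub>R w' k) \<bullet> (W *v (lam *\<^sub>R w' k))) \<le> sqrt (2 * lam) * norm (w' k)"
        by (simp add: real_sqrt_mult)
      have "\<bar>v \<bullet> \<eta> k\<bar> = real (k + 1) * \<bar>v \<bullet> (W *v (T k - lam *\<^sub>R w' k))\<bar>"
        unfolding \<eta>_eq by (simp add: abs_mult)
      also have "\<dots> \<le> real (k + 1) * (sqrt (v \<bullet> (W *v v)) *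
          sqrt ((T k - lam *\<^sub>R w' k) \<bullet> (W *v (T k - lam *\<^sub>R w' k))))"
        unfolding W_def by (intro mult_left_mono gram_inv_Cauchy_Schwarz[OF lam_pos]) auto
      also have "\<dots> = c * sqrt ((T k - lam *\<^sub>R w' k) \<bullet> (W *v (T k - lam *\<^sub>R w' k)))"
        by (simp add: c_def mult.assoc)
      also have "\<dots> \<le> c * (sqrt (2 * lam) * norm (w' k) + rad)"
        using sqrt_gram_inv_quadratic_triangle[OF lam_pos, of "T k" "lam *\<^sub>R w' k" "\<lambda>t. ph t x" N] 1 2 c0
        unfolding W_def by (intro mult_left_mono) auto
      finally have "ereal \<bar>v \<bullet> \<eta> k\<bar> \<le> ereal c * (ereal (sqrt (2 * lam)) * ereal (norm (w' k)) + ereal rad)"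
        by simp
      \<comment> \<open>From here in extended reals, where an infinite \<open>omega\<close> is
        allowed.\<close>
      also have "\<dots> \<le> ereal c * (ereal (sqrt (2 * lam)) * omega S A \<phi> + ereal rad)"
      proof (intro ereal_mult_left_mono add_right_mono)
        show "ereal (norm (w' k)) \<le> omega S A \<phi>"
          unfolding omega_def
        proof (rule Sup_upper, intro CollectI exI conjI)
          show "\<forall>x\<in>space S. \<forall>y\<in>space A. 0 \<le> \<phi> x y \<bullet> w' k \<and> \<phi> x y \<bullet> w' k \<le> 1"
            using Q_bd[of _ _ k] wq[of _ _ k] by (simp add: w'_def)
        qed simp
      qed (use c0 lam_pos in auto)
      finally show ?thesis
        by (simp add: k_def v_def c_def)
    qed
    have "vhat H \<nu> Rh Mh - vpi \<xi>0 p \<pi> r H = \<nu> \<bullet> (west Rh Mh (Suc H) - wt (Suc H))"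
      by (simp add: vhat_def vpi_eq \<nu>_def wt_def inner_diff_right del: west.simps)
    also have "\<dots> = (\<Sum>h<Suc H. nuhat Mh \<nu> h \<bullet> \<eta> (Suc H - 1 - h))"
      by (rule inner_west_diff) (auto simp: \<eta>_def wt_def)
    also have "\<dots> = (\<Sum>h=0..H. nuhat Mh \<nu> h \<bullet> \<eta> (H - h))"
      by (intro sum.cong) auto
    finally have "\<bar>vpi \<xi>0 p \<pi> r H - vhat H \<nu> Rh Mh\<bar> \<le> (\<Sum>h=0..H. \<bar>nuhat Mh \<nu> h \<bullet> \<eta> (H - h)\<bar>)"
      by (metis abs_minus_commute sum_abs)
    then have "ereal \<bar>vpi \<xi>0 p \<pi> r H - vhat H \<nu> Rh Mh\<bar> \<le> (\<Sum>h=0..H. ereal \<bar>nuhat Mh \<nu> h \<bullet> \<eta> (H - h)\<bar>)"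
      by simp
    also have "\<dots> \<le> (\<Sum>h=0..H. ereal (real (H - h + 1) * sqrt (nuhat Mh \<nu> h \<bullet> (W *v nuhat Mh \<nu> h))) *
          (ereal (sqrt (2 * lam)) * omega S A \<phi> + ereal rad))"
      by (intro sum_mono step_bound)
    finally show "let d = real CARD('d);
           Sig = SigmaHat lam \<phi> N (\<lambda>t. s t x) (\<lambda>t. a t x);
           Rh = RHat lam \<phi> N (\<lambda>t. s t x) (\<lambda>t. a t x) (\<lambda>t. rw t x);
           Mh = MHat lam \<phi> \<pi> N (\<lambda>t. s t x) (\<lambda>t. a t x) (\<lambda>t. s' t x);
           \<nu> = nu0 \<xi>0 \<pi> \<phi>;
           L = ln (3 * real N ^ 2 * real H / \<delta>)
       in ereal \<bar>vpi \<xi>0 p \<pi> r H - vhat H \<nu> Rh Mh\<bar>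
          \<le> (\<Sum>h=0..H. ereal (real (H - h + 1) *
                 sqrt (nuhat Mh \<nu> h \<bullet> (matrix_inv Sig *v nuhat Mh \<nu> h))) *
               (ereal (sqrt (2 * lam)) * omega S A \<phi> +
                ereal (2 * sqrt (2 * d * ln (1 + real N / (lam * d)) * L) + 4 / 3 * L)))"
      unfolding Let_def d_def[symmetric] Sig_def[symmetric] Rh_def[symmetric] Mh_def[symmetric]
        \<nu>_def[symmetric] L_def[symmetric] inv rad_def .
  qed (fact E0_prob)
qed

end
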